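(* Let $\rho:(a,b)\to\mathcal{P}_+(G)$ be a smooth curve and let $\sigma(t)\in T_{\rho(t)}\mathcal{P}_+(G)$ be a smooth vector field along $\rho$. The equation for $\sigma(t)$ to be parallel along $\rho(t)$ in $(\mathcal{P}_+(G),g_W)$ is $$\dot\sigma-\frac12\big(L(\sigma)L(\rho)^\dagger\dot\rho+L(\dot\rho)L(\rho)^\dagger\sigma\big)+\frac12L(\rho)\Big(\nabla_GL(\rho)^\dagger\dot\rho\circ\nabla_GL(\rho)^\dagger\sigma\Big)=0.$$ The geodesic equation is $$\ddot\rho-L(\dot\rho)L(\rho)^\dagger\dot\rho+\frac12L(\rho)\big(\nabla_GL(\rho)^\dagger\dot\rho\circ\nabla_GL(\rho)^\dagger\dot\rho\big)=0.$$
   Context: $G=(V,E,\omega)$ is a connected, weighted, undirected finite graph with vertex set $V=\{1,\dots,n\}$, edge set $E$ and weights $\omega_{ij}=\omega_{ji}>0$ if $(i,j)\in E$, $\omega_{ij}=0$ otherwise; $N(i)=\{j:(i,j)\in E\}$. For $\Phi\in\mathbb{R}^n$, $\nabla_G\Phi=(\nabla_{ij}\Phi)$ with $\nabla_{ij}\Phi=\sqrt{\omega_{ij}}(\Phi(i)-\Phi(j))$; for edge fields $v,\tilde v$, $v\circ\tilde v=\frac12\big(\sum_{j\in N(i)}v_{ij}\tilde v_{ij}\big)_{i=1}^n\in\mathbb{R}^n$. For $a\in\mathbb{R}^n$ put $\theta_{ij}(a)=\frac{a_i+a_j}{2}$; the linear weighted Laplacian matrix $L(a)\in\mathbb{R}^{n\times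 n}$ is given by $(L(a)\Phi)(i)=\sum_{j\in N(i)}\omega_{ij}\theta_{ij}(a)(\Phi(i)-\Phi(j))$. $A^\dagger$ is the Moore-Penrose pseudo-inverse. $\mathcal{P}_+(G)=\{\rho\in\mathbb{R}^n:\sum_i\rho_i=1,\ \rho_i>0\}$, with tangent space $T_\rho\mathcal{P}_+(G)=\{\sigma\in\mathbb{R}^n:\sum_i\sigma_i=0\}$, carries the Riemannian metric $g_W(\sigma_1,\sigma_2)=\sigma_1^{\mathsf T}L(\rho)^\dagger\sigma_2$. Parallel transport and geodesics are those of its Levi-Civita connection. *)

theory Defs
  imports "HOL-Analysis.Analysis"
begin

section \<open>Weighted graphs and the linear weighted Laplacian\<close>

definition connected_weighted_graph :: "('n::finite \<times> 'n) set \<Rightarrow> ('n \<Rightarrow> 'n \<Rightarrow> real) \<Rightarrow> bool" where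
  "connected_weighted_graph E \<omega> \<longleftrightarrow>
     sym E \<and> (\<forall>i j. (i, j) \<in> E\<^sup>*) \<and>
     (\<forall>i j. \<omega> i j = \<omega> j i) \<and>
     (\<forall>i j. if (i, j) \<in> E then \<omega> i j > 0 else \<omega> i j = 0)"

definition neighbours :: "('n \<times> 'n) set \<Rightarrow> 'n \<Rightarrow> 'n set" where
  "neighbours E i = {j. (i, j) \<in> E}"

definition graph_grad :: "('n \<Rightarrow> 'n \<Rightarrow> real) \<Rightarrow> real^'n::finite \<Rightarrow> 'n \<Rightarrow> 'n \<Rightarrow> real" where
  "graph_grad \<omega> \<Phi> = (\<lambda>i j. sqrt (\<omega> i j) * (\<Phi> $ i - \<Phi> $ j))"

definition field_prod ::
  "('n::finite \<times> 'n) set \<Rightarrow> ('n \<Rightarrow> 'n \<Rightarrow> real) \<Rightarrow> ('n \<Rightarrow> 'n \<Rightarrow> real) \<Rightarrow> real^'n" where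
  "field_prod E v w = (\<chi> i. (1/2) * (\<Sum>j\<in>neighbours E i. v i j * w i j))"

definition edge_mean :: "real^'n::finite \<Rightarrow> 'n \<Rightarrow> 'n \<Rightarrow> real" where
  "edge_mean a i j = (a $ i + a $ j) / 2"

definition laplacian ::
  "('n::finite \<times> 'n) set \<Rightarrow> ('n \<Rightarrow> 'n \<Rightarrow> real) \<Rightarrow> real^'n \<Rightarrow> real^'n^'n" where
  "laplacian E \<omega> a =
     matrix (\<lambda>\<Phi>. \<chi> i. \<Sum>j\<in>neighbours E i. \<omega> i j * edge_mean a i j * (\<Phi> $ i - \<Phi> $ j))"

definition is_pseudo_inverse :: "real^'n^'m \<Rightarrow> real^'m^'n \<Rightarrow> bool" where
  "is_pseudo_inverse A B \<longleftrightarrow>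
     A ** B ** A = A \<and> B ** A ** B = B \<and>
     transpose (A ** B) = A ** B \<and> transpose (B ** A) = B ** A"

definition pseudo_inverse :: "real^'n^'m \<Rightarrow> real^'m^'n"  ("_\<^sup>\<dagger>" [1000] 999) where
  "A\<^sup>\<dagger> = (THE B. is_pseudo_inverse A B)"


section \<open>The manifold of positive probability vectors\<close>

definition prob_plus :: "(real^'n::finite) set" where
  "prob_plus = {\<rho>. (\<Sum>i\<in>UNIV. \<rho> $ i) = 1 \<and> (\<forall>i. \<rho> $ i > 0)}"

text \<open>The tangent space is the same subspace at every point; hence vector fields, also those
  along curves, are represented by functions with values in it.\<close>

definition tangent :: "(real^'n::finite) set" where
  "tangent = {\<sigma>. (\<Sum>i\<in>UNIV. \<sigma> $ i) = 0}"

definition wasserstein_metric ::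
  "('n::finite \<times> 'n) set \<Rightarrow> ('n \<Rightarrow> 'n \<Rightarrow> real) \<Rightarrow> real^'n \<Rightarrow> real^'n \<Rightarrow> real^'n \<Rightarrow> real" where
  "wasserstein_metric E \<omega> \<rho> \<sigma>\<^sub>1 \<sigma>\<^sub>2 = \<sigma>\<^sub>1 \<bullet> ((laplacian E \<omega> \<rho>)\<^sup>\<dagger> *v \<sigma>\<^sub>2)"


section \<open>Smoothness\<close>

definition dir_deriv ::
  "('a::real_normed_vector \<Rightarrow> 'b::real_normed_vector) \<Rightarrow> 'a \<Rightarrow> 'a \<Rightarrow> 'b" where
  "dir_deriv f u x = vector_derivative (\<lambda>s. f (x + s *\<^sub>R u)) (at 0)"

text \<open>These notions are used only for sets \<open>S\<close> that are open in an affine subspace with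
  direction space \<open>U\<close>: the simplex \<open>prob_plus\<close> with \<open>U = tangent\<close>, and open real intervals with
  \<open>U = UNIV\<close>. Only the values of \<open>f\<close> on \<open>S\<close> matter then.\<close>

primrec Ck_on ::
  "nat \<Rightarrow> 'a set \<Rightarrow> 'a set \<Rightarrow> ('a::real_normed_vector \<Rightarrow> 'b::real_normed_vector) \<Rightarrow> bool" where
  "Ck_on 0 U S f \<longleftrightarrow> continuous_on S f"
| "Ck_on (Suc k) U S f \<longleftrightarrow> f differentiable_on S \<and> (\<forall>u\<in>U. Ck_on k U S (dir_deriv f u))"

definition smooth_on ::
  "'a set \<Rightarrow> 'a set \<Rightarrow> ('a::real_normed_vector \<Rightarrow> 'b::real_normed_vector) \<Rightarrow> bool" where
  "smooth_on U S f \<longleftrightarrow> (\<forall>k. Ck_on k U S f)"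

definition smooth_functions :: "(real^'n::finite \<Rightarrow> real) set" where
  "smooth_functions = {f. smooth_on tangent prob_plus f}"

definition vector_fields :: "(real^'n::finite \<Rightarrow> real^'n) set" where
  "vector_fields = {X. smooth_on tangent prob_plus X \<and> (\<forall>\<rho>\<in>prob_plus. X \<rho> \<in> tangent)}"

definition smooth_curve :: "real set \<Rightarrow> (real \<Rightarrow> real^'n::finite) \<Rightarrow> bool" where
  "smooth_curve I \<rho> \<longleftrightarrow> smooth_on UNIV I \<rho> \<and> (\<forall>t\<in>I. \<rho> t \<in> prob_plus)"

definition fields_along :: "real set \<Rightarrow> (real \<Rightarrow> real^'n::finite) set" where
  "fields_along I = {\<sigma>. smooth_on UNIV I \<sigma> \<and> (\<forall>t\<in>I. \<sigma> t \<in> tangent)}"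


section \<open>The Levi-Civita connection and parallel transport\<close>

type_synonym 'n field = "real^'n \<Rightarrow> real^'n"

definition lie_bracket :: "'n::finite field \<Rightarrow> 'n field \<Rightarrow> 'n field" where
  "lie_bracket X Y = (\<lambda>\<rho>. dir_deriv Y (X \<rho>) \<rho> - dir_deriv X (Y \<rho>) \<rho>)"

text \<open>The clause on \<open>X'\<close> and \<open>Y'\<close> says that \<open>D\<close> depends only on the restrictions of its arguments
  to the simplex, that is, on the vector fields themselves.\<close>

definition affine_connection :: "('n::finite field \<Rightarrow> 'n field \<Rightarrow> 'n field) \<Rightarrow> bool" where
  "affine_connection D \<longleftrightarrow>
     (\<forall>X\<in>vector_fields. \<forall>Y\<in>vector_fields. D X Y \<in> vector_fields) \<and>
     (\<forall>X\<in>vector_fields. \<forall>X'\<in>vector_fields. \<forall>Y\<in>vector_fields. \<forall>Y'\<in>vector_fields.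
        (\<forall>\<rho>\<in>prob_plus. X \<rho> = X' \<rho> \<and> Y \<rho> = Y' \<rho>) \<longrightarrow> (\<forall>\<rho>\<in>prob_plus. D X Y \<rho> = D X' Y' \<rho>)) \<and>
     (\<forall>X\<in>vector_fields. \<forall>X'\<in>vector_fields. \<forall>Y\<in>vector_fields. \<forall>\<rho>\<in>prob_plus.
        D (\<lambda>x. X x + X' x) Y \<rho> = D X Y \<rho> + D X' Y \<rho>) \<and>
     (\<forall>X\<in>vector_fields. \<forall>Y\<in>vector_fields. \<forall>Y'\<in>vector_fields. \<forall>\<rho>\<in>prob_plus.
        D X (\<lambda>x. Y x + Y' x) \<rho> = D X Y \<rho> + D X Y' \<rho>) \<and>
     (\<forall>f\<in>smooth_functions. \<forall>X\<in>vector_fields. \<forall>Y\<in>vector_fields. \<forall>\<rho>\<in>prob_plus.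
        D (\<lambda>x. f x *\<^sub>R X x) Y \<rho> = f \<rho> *\<^sub>R D X Y \<rho>) \<and>
     (\<forall>f\<in>smooth_functions. \<forall>X\<in>vector_fields. \<forall>Y\<in>vector_fields. \<forall>\<rho>\<in>prob_plus.
        D X (\<lambda>x. f x *\<^sub>R Y x) \<rho> = f \<rho> *\<^sub>R D X Y \<rho> + dir_deriv f (X \<rho>) \<rho> *\<^sub>R Y \<rho>)"

definition levi_civita ::
  "(real^'n \<Rightarrow> real^'n \<Rightarrow> real^'n \<Rightarrow> real) \<Rightarrow> ('n::finite field \<Rightarrow> 'n field \<Rightarrow> 'n field) \<Rightarrow> bool" where
  "levi_civita g D \<longleftrightarrow>
     affine_connection D \<and>
     (\<forall>X\<in>vector_fields. \<forall>Y\<in>vector_fields. \<forall>\<rho>\<in>prob_plus.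
        D X Y \<rho> - D Y X \<rho> = lie_bracket X Y \<rho>) \<and>
     (\<forall>X\<in>vector_fields. \<forall>Y\<in>vector_fields. \<forall>Z\<in>vector_fields. \<forall>\<rho>\<in>prob_plus.
        dir_deriv (\<lambda>x. g x (Y x) (Z x)) (X \<rho>) \<rho> = g \<rho> (D X Y \<rho>) (Z \<rho>) + g \<rho> (Y \<rho>) (D X Z \<rho>))"

text \<open>The covariant derivative along a curve \<open>\<rho>\<close> on an open interval \<open>I\<close> induced by a connection
  \<open>D\<close>: an additive operator on vector fields along \<open>\<rho>\<close> that satisfies the Leibniz rule and
  maps the restriction \<open>X \<circ> \<rho>\<close> of a vector field \<open>X\<close> to the derivative of \<open>X\<close> in direction \<open>\<rho>'\<close>.
  By tensoriality in \<open>Z\<close>, the latter is the value at \<open>\<rho> t\<close> of \<open>D Z X\<close> for any vector field \<open>Z\<close> with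
  \<open>Z (\<rho> t) = \<rho>' t\<close>. Homogeneity over the reals is the Leibniz rule for constant \<open>f\<close>.\<close>

definition covariant_derivative_along ::
  "('n::finite field \<Rightarrow> 'n field \<Rightarrow> 'n field) \<Rightarrow> real set \<Rightarrow> (real \<Rightarrow> real^'n) \<Rightarrow>
   ((real \<Rightarrow> real^'n) \<Rightarrow> (real \<Rightarrow> real^'n)) \<Rightarrow> bool" where
  "covariant_derivative_along D I \<rho> DD \<longleftrightarrow>
     (\<forall>\<sigma>\<in>fields_along I. DD \<sigma> \<in> fields_along I) \<and>
     (\<forall>\<sigma>\<in>fields_along I. \<forall>\<tau>\<in>fields_along I.
        (\<forall>t\<in>I. \<sigma> t = \<tau> t) \<longrightarrow> (\<forall>t\<in>I. DD \<sigma> t = DD \<tau> t)) \<and>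
     (\<forall>\<sigma>\<in>fields_along I. \<forall>\<tau>\<in>fields_along I. \<forall>t\<in>I.
        DD (\<lambda>s. \<sigma> s + \<tau> s) t = DD \<sigma> t + DD \<tau> t) \<and>
     (\<forall>f. smooth_on UNIV I f \<longrightarrow> (\<forall>\<sigma>\<in>fields_along I. \<forall>t\<in>I.
        DD (\<lambda>s. f s *\<^sub>R \<sigma> s) t = f t *\<^sub>R DD \<sigma> t + vector_derivative f (at t) *\<^sub>R \<sigma> t)) \<and>
     (\<forall>X\<in>vector_fields. \<forall>Z\<in>vector_fields. \<forall>t\<in>I.
        Z (\<rho> t) = vector_derivative \<rho> (at t) \<longrightarrow> DD (\<lambda>s. X (\<rho> s)) t = D Z X (\<rho> t))"

text \<open>On the simplex and on \<open>I\<close>, the operators \<open>D\<close> and \<open>DD\<close> below are unique.\<close>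

definition parallel_along ::
  "(real^'n \<Rightarrow> real^'n \<Rightarrow> real^'n \<Rightarrow> real) \<Rightarrow> real set \<Rightarrow> (real \<Rightarrow> real^'n::finite) \<Rightarrow>
   (real \<Rightarrow> real^'n) \<Rightarrow> bool" where
  "parallel_along g I \<rho> \<sigma> \<longleftrightarrow>
     (\<exists>D DD. levi_civita g D \<and> covariant_derivative_along D I \<rho> DD \<and> (\<forall>t\<in>I. DD \<sigma> t = 0))"

definition geodesic ::
  "(real^'n \<Rightarrow> real^'n \<Rightarrow> real^'n \<Rightarrow> real) \<Rightarrow> real set \<Rightarrow> (real \<Rightarrow> real^'n::finite) \<Rightarrow> bool" where
  "geodesic g I \<rho> \<longleftrightarrow> parallel_along g I \<rho> (\<lambda>t. vector_derivative \<rho> (at t))"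

end

theory Submission
  imports Defs
begin

text \<open>For tangent vectors \<open>u\<close>, \<open>v\<close> at a density \<open>\<rho>\<close> let \<open>\<Phi>\<^sub>u\<close>, \<open>\<Phi>\<^sub>v\<close> be their potentials, the
  images under the pseudo-inverse of the Laplacian at \<open>\<rho>\<close>.  The energy form of the weighted
  Laplacian is linear in the weight vector: its value at two potentials is the Euclidean inner
  product of the weight vector with the vertexwise product of their gradients
  (\<open>inner_laplacian\<close>).  Differentiating the identity that the Laplacian maps potentials back to
  vectors shows that, for constant vector fields, the derivative of the metric in direction \<open>w\<close> is
  minus the energy form weighted by \<open>w\<close>, taken at the potentials (\<open>dir_deriv_metric\<close>).  The
  Koszul formula for constant fields therefore consists of three energies.  With respect to the
  metric, two of them are represented by the Laplacian weighted by \<open>v\<close> applied to \<open>\<Phi>\<^sub>u\<close> and the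
  one weighted by \<open>u\<close> applied to \<open>\<Phi>\<^sub>v\<close>; the third is weighted by the test vector and is
  represented by the Laplacian at \<open>\<rho>\<close> applied to the product of the gradients.  Half their signed
  sum is \<open>christoffel\<close>, and both equations say that the derivative of the field plus this
  correction, evaluated at the velocity and the field, vanishes.

  Parallelism asserts the existence of a Levi-Civita connection and a covariant derivative, so
  that there are two halves.  For existence, adding the correction to the flat derivative gives
  such operators (\<open>levi_civita_wasserstein\<close>, \<open>covariant_derivative_along_wasserstein\<close>); the
  analytic content is that the correction is smooth, because potentials solve a regular linear
  system and Cramer's rule applies (\<open>smooth_on_laplacian_pseudo_inverse\<close>).  For uniqueness it
  suffices to know a Levi-Civita connection on constant fields (\<open>levi_civita_on_constants\<close>),
  because every field along a curve is a combination of constant fields with smooth coefficients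
  (\<open>covariant_derivative_along_unique\<close>).\<close>

section \<open>Smooth maps on relatively open sets\<close>

text \<open>Differentiability within \<^term>\<open>S\<close> constrains a derivative only in the directions in
  which \<^term>\<open>S\<close> is open.  The following condition says that these directions include
  \<^term>\<open>U\<close>, which makes \<^const>\<open>dir_deriv\<close> along \<^term>\<open>U\<close> the value of any derivative
  within \<^term>\<open>S\<close>.\<close>

definition open_along :: "'a::real_normed_vector set \<Rightarrow> 'a set \<Rightarrow> bool" where
  "open_along U S \<longleftrightarrow> (\<forall>x\<in>S. \<forall>u\<in>U. \<forall>\<^sub>F s in nhds (0::real). x + s *\<^sub>R u \<in> S)"

lemma has_vector_derivative_along:
  assumes "open_along U S" "x \<in> S" "u \<in> U" "(f has_derivative f') (at x within S)"
  shows "((\<lambda>s. f (x + s *\<^sub>R u)) has_vector_derivative f' u) (at 0)"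
proof -
  let ?l = "\<lambda>s::real. x + s *\<^sub>R u"
  let ?T = "{s. ?l s \<in> S}"
  have ev: "\<forall>\<^sub>F s in nhds 0. s \<in> ?T"
    using assms(1-3) by (auto simp: open_along_def)
  then obtain V where V: "open V" "0 \<in> V" "V \<subseteq> ?T"
    by (auto simp: eventually_nhds)
  have "(?l has_derivative (\<lambda>s. s *\<^sub>R u)) (at 0 within ?T)"
    by (auto intro!: derivative_eq_intros)
  moreover have "(f has_derivative f') (at (?l 0) within (?l ` ?T))"
    using assms(4) by (auto intro: has_derivative_subset)
  ultimately have "((\<lambda>s. f (?l s)) has_derivative (\<lambda>s. f' (s *\<^sub>R u))) (at 0 within ?T)"
    by (rule has_derivative_in_compose)
  then have "((\<lambda>s. f (?l s)) has_derivative (\<lambda>s. f' (s *\<^sub>R u))) (at 0 within V)"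
    using V(3) by (rule has_derivative_subset)
  then have "((\<lambda>s. f (?l s)) has_derivative (\<lambda>s. f' (s *\<^sub>R u))) (at 0)"
    using V at_within_open by metis
  moreover have "(\<lambda>s. f' (s *\<^sub>R u)) = (\<lambda>s. s *\<^sub>R f' u)"
    using has_derivative_bounded_linear[OF assms(4)]
    by (simp add: linear_simps(5) bounded_linear.linear linear_cmul)
  ultimately show ?thesis
    by (simp add: has_vector_derivative_def)
qed

lemma dir_deriv_eq:
  assumes "open_along U S" "x \<in> S" "u \<in> U" "(f has_derivative f') (at x within S)"
  shows "dir_deriv f u x = f' u"
  unfolding dir_deriv_def
  by (rule vector_derivative_at[OF has_vector_derivative_along[OF assms]])

lemma dir_deriv_cong:
  assumes "open_along U S" "\<And>y. y \<in> S \<Longrightarrow> f y = g y" "x \<in> S" "u \<in> U"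
  shows "dir_deriv f u x = dir_deriv g u x"
proof -
  have "\<forall>\<^sub>F s in nhds 0. x + s *\<^sub>R u \<in> S"
    using assms by (auto simp: open_along_def)
  then have "\<forall>\<^sub>F s in nhds 0. s \<in> UNIV \<longrightarrow> f (x + s *\<^sub>R u) = g (x + s *\<^sub>R u)"
    by eventually_elim (simp add: assms(2))
  then show ?thesis
    unfolding dir_deriv_def by (rule vector_derivative_cong_eq) auto
qed

lemma dir_deriv_const [simp]: "dir_deriv (\<lambda>x. c) u x = 0"
  by (simp add: dir_deriv_def)

text \<open>The calculus rules describe an iterated \<^const>\<open>dir_deriv\<close> only at points of \<^term>\<open>S\<close>; this
  congruence makes such a description sufficient.\<close>

lemma Ck_on_cong_imp:
  assumes "open_along U S" "\<And>x. x \<in> S \<Longrightarrow> f x = g x" "Ck_on k U S f"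
  shows "Ck_on k U S g"
  using assms(2,3)
proof (induction k arbitrary: f g)
  case 0
  then show ?case by (auto cong: continuous_on_cong)
next
  case (Suc k)
  have "g differentiable_on S"
    using Suc.prems unfolding differentiable_on_def differentiable_def Ck_on.simps
    by (metis has_derivative_transform)
  moreover have "Ck_on k U S (dir_deriv g u)" if "u \<in> U" for u
  proof (rule Suc.IH)
    show "Ck_on k U S (dir_deriv f u)"
      using Suc.prems that by simp
    show "dir_deriv f u x = dir_deriv g u x" if "x \<in> S" for x
      using dir_deriv_cong[OF assms(1) Suc.prems(1) that \<open>u \<in> U\<close>] .
  qed
  ultimately show ?case by simp
qed

lemma Ck_on_SucD: "Ck_on (Suc k) U S f \<Longrightarrow> Ck_on k U S f"
proof (induction k arbitrary: f)
  case 0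
  then show ?case by (simp add: differentiable_imp_continuous_on)
qed auto

lemma Ck_on_has_derivative:
  assumes "Ck_on (Suc k) U S f"
  shows "\<exists>f'. \<forall>x\<in>S. (f has_derivative f' x) (at x within S)"
  using assms unfolding differentiable_on_def differentiable_def Ck_on.simps by (auto intro: bchoice)

text \<open>All closure properties of smooth maps follow the same pattern: an induction on the order
  of differentiability, in which the directional derivatives of the new map are expressed on
  \<^term>\<open>S\<close> by maps of the same kind.\<close>

lemma Ck_on_SucI:
  assumes "open_along U S"
    and "\<And>x. x \<in> S \<Longrightarrow> (f has_derivative f' x) (at x within S)"
    and "\<And>u. u \<in> U \<Longrightarrow> Ck_on k U S (\<lambda>x. f' x u)"
  shows "Ck_on (Suc k) U S f"
proof -
  have "f differentiable_on S"
    using assms(2) unfolding differentiable_on_def differentiable_def by blast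
  moreover have "Ck_on k U S (dir_deriv f u)" if "u \<in> U" for u
    by (rule Ck_on_cong_imp[OF assms(1) _ assms(3)[OF that]])
      (simp add: dir_deriv_eq[OF assms(1) _ that assms(2)])
  ultimately show ?thesis by simp
qed

lemma Ck_on_const: "open_along U S \<Longrightarrow> Ck_on k U S (\<lambda>x. c)"
proof (induction k arbitrary: c)
  case (Suc k)
  show ?case
    by (rule Ck_on_SucI[where f' = "\<lambda>x u. 0"]) (use Suc in auto)
qed auto

lemma Ck_on_ident: "open_along U S \<Longrightarrow> Ck_on k U S (\<lambda>x. x)"
proof (induction k)
  case (Suc k)
  show ?case
    by (rule Ck_on_SucI[where f' = "\<lambda>x u. u"]) (use Suc Ck_on_const in auto)
qed auto

lemma Ck_on_add:
  assumes "open_along U S" "Ck_on k U S f" "Ck_on k U S g"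
  shows "Ck_on k U S (\<lambda>x. f x + g x)"
  using assms(2,3)
proof (induction k arbitrary: f g)
  case 0
  then show ?case by (auto intro: continuous_intros)
next
  case (Suc k)
  obtain f' where "\<forall>x\<in>S. (f has_derivative f' x) (at x within S)"
    using Ck_on_has_derivative[OF Suc.prems(1)] by (rule exE)
  then have der1: "\<And>x. x \<in> S \<Longrightarrow> (f has_derivative f' x) (at x within S)"
    by (rule bspec)
  obtain g' where "\<forall>x\<in>S. (g has_derivative g' x) (at x within S)"
    using Ck_on_has_derivative[OF Suc.prems(2)] by (rule exE)
  then have der2: "\<And>x. x \<in> S \<Longrightarrow> (g has_derivative g' x) (at x within S)"
    by (rule bspec)
  note der = der1 der2
  show ?case
  proof (rule Ck_on_SucI[OF assms(1)])
    show "((\<lambda>x. f x + g x) has_derivative (\<lambda>u. f' x u + g' x u)) (at x within S)" if "x \<in> S" for x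
      using der that by (intro has_derivative_add)
    show "Ck_on k U S (\<lambda>x. f' x u + g' x u)" if "u \<in> U" for u
      using Ck_on_cong_imp[OF assms(1) _ Suc.IH[of "dir_deriv f u" "dir_deriv g u"]]
        Suc.prems that dir_deriv_eq[OF assms(1) _ that der(1)] dir_deriv_eq[OF assms(1) _ that der(2)]
      by (simp add: fun_eq_iff)
  qed
qed

lemma Ck_on_bounded_linear:
  assumes "open_along U S" "bounded_linear h" "Ck_on k U S f"
  shows "Ck_on k U S (\<lambda>x. h (f x))"
  using assms(3)
proof (induction k arbitrary: f)
  case 0
  then show ?case using bounded_linear.continuous_on[OF assms(2)] by auto
next
  case (Suc k)
  obtain f' where "\<forall>x\<in>S. (f has_derivative f' x) (at x within S)"
    using Ck_on_has_derivative[OF Suc.prems(1)] by (rule exE)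
  then have der: "\<And>x. x \<in> S \<Longrightarrow> (f has_derivative f' x) (at x within S)"
    by (rule bspec)
  show ?case
  proof (rule Ck_on_SucI[OF assms(1)])
    show "((\<lambda>x. h (f x)) has_derivative (\<lambda>u. h (f' x u))) (at x within S)" if "x \<in> S" for x
      using bounded_linear.has_derivative[OF assms(2) der[OF that]] .
    show "Ck_on k U S (\<lambda>x. h (f' x u))" if "u \<in> U" for u
      using Ck_on_cong_imp[OF assms(1) _ Suc.IH[of "dir_deriv f u"]]
        Suc.prems that dir_deriv_eq[OF assms(1) _ that der(1)]
      by simp
  qed
qed

lemma Ck_on_bounded_bilinear:
  assumes "open_along U S" "bounded_bilinear h" "Ck_on k U S f" "Ck_on k U S g"
  shows "Ck_on k U S (\<lambda>x. h (f x) (g x))"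
  using assms(3,4)
proof (induction k arbitrary: f g)
  case 0
  then show ?case using bounded_bilinear.continuous_on[OF assms(2)] by auto
next
  case (Suc k)
  obtain f' where "\<forall>x\<in>S. (f has_derivative f' x) (at x within S)"
    using Ck_on_has_derivative[OF Suc.prems(1)] by (rule exE)
  then have der1: "\<And>x. x \<in> S \<Longrightarrow> (f has_derivative f' x) (at x within S)"
    by (rule bspec)
  obtain g' where "\<forall>x\<in>S. (g has_derivative g' x) (at x within S)"
    using Ck_on_has_derivative[OF Suc.prems(2)] by (rule exE)
  then have der2: "\<And>x. x \<in> S \<Longrightarrow> (g has_derivative g' x) (at x within S)"
    by (rule bspec)
  note der = der1 der2
  show ?case
  proof (rule Ck_on_SucI[OF assms(1)])
    show "((\<lambda>x. h (f x) (g x)) has_derivative (\<lambda>u. h (f x) (g' x u) + h (f' x u) (g x)))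
        (at x within S)" if "x \<in> S" for x
      using der that by (intro bounded_bilinear.FDERIV[OF assms(2)])
    show "Ck_on k U S (\<lambda>x. h (f x) (g' x u) + h (f' x u) (g x))" if "u \<in> U" for u
    proof (rule Ck_on_cong_imp[OF assms(1)])
      have "Ck_on k U S (dir_deriv f u)" "Ck_on k U S (dir_deriv g u)"
        using Suc.prems that by auto
      note IH = Suc.IH[OF Ck_on_SucD[OF Suc.prems(1)] this(2)]
        Suc.IH[OF this(1) Ck_on_SucD[OF Suc.prems(2)]]
      show "Ck_on k U S (\<lambda>x. h (f x) (dir_deriv g u x) + h (dir_deriv f u x) (g x))"
        by (rule Ck_on_add[OF assms(1) IH])
    qed (simp add: dir_deriv_eq[OF assms(1) _ that der(1)] dir_deriv_eq[OF assms(1) _ that der(2)])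
  qed
qed

text \<open>The derivative of a reciprocal is a product of the derivative of the function with two
  copies of the reciprocal, so the induction needs no other functions.\<close>

lemma Ck_on_inverse:
  fixes f :: "'a::real_normed_vector \<Rightarrow> real"
  assumes "open_along U S" "\<And>x. x \<in> S \<Longrightarrow> f x \<noteq> 0" "Ck_on k U S f"
  shows "Ck_on k U S (\<lambda>x. inverse (f x))"
  using assms(3)
proof (induction k)
  case 0
  then show ?case using assms(2) by (auto intro!: continuous_intros)
next
  case (Suc k)
  obtain f' where "\<forall>x\<in>S. (f has_derivative f' x) (at x within S)"
    using Ck_on_has_derivative[OF Suc.prems(1)] by (rule exE)
  then have der: "\<And>x. x \<in> S \<Longrightarrow> (f has_derivative f' x) (at x within S)"
    by (rule bspec)
  note mult = Ck_on_bounded_bilinear[OF assms(1) bounded_bilinear_mult]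
  show ?case
  proof (rule Ck_on_SucI[OF assms(1)])
    show "((\<lambda>x. inverse (f x)) has_derivative (\<lambda>u. - (inverse (f x) * f' x u * inverse (f x))))
        (at x within S)" if "x \<in> S" for x
      using Deriv.has_derivative_inverse[OF assms(2)[OF that] der[OF that]] .
    show "Ck_on k U S (\<lambda>x. - (inverse (f x) * f' x u * inverse (f x)))" if "u \<in> U" for u
    proof (rule Ck_on_cong_imp[OF assms(1)])
      have "Ck_on k U S (\<lambda>x. inverse (f x))" "Ck_on k U S (dir_deriv f u)"
        using Suc.IH Ck_on_SucD Suc.prems that by auto
      then show "Ck_on k U S (\<lambda>x. - 1 * (inverse (f x) * dir_deriv f u x * inverse (f x)))"
        by (intro mult Ck_on_const[OF assms(1)])
    qed (simp add: dir_deriv_eq[OF assms(1) _ that der])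
  qed
qed

lemma smooth_onI: "(\<And>k. Ck_on k U S f) \<Longrightarrow> smooth_on U S f"
  by (simp add: smooth_on_def)

lemma smooth_onD: "smooth_on U S f \<Longrightarrow> Ck_on k U S f"
  by (simp add: smooth_on_def)

lemma smooth_on_cong:
  assumes "open_along U S" "\<And>x. x \<in> S \<Longrightarrow> f x = g x"
  shows "smooth_on U S f \<longleftrightarrow> smooth_on U S g"
proof
  show "smooth_on U S g" if "smooth_on U S f"
    by (rule smooth_onI, rule Ck_on_cong_imp[OF assms smooth_onD[OF that]])
  show "smooth_on U S f" if "smooth_on U S g"
    by (rule smooth_onI, rule Ck_on_cong_imp[OF assms(1) assms(2)[symmetric] smooth_onD[OF that]])
qed

lemma smooth_on_has_derivative:
  assumes "smooth_on U S f" "x \<in> S"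
  obtains f' where "(f has_derivative f') (at x within S)"
proof -
  have "Ck_on (Suc 0) U S f"
    using assms(1) by (rule smooth_onD)
  then have "f differentiable_on S" by simp
  then show ?thesis
    using that assms(2) unfolding differentiable_on_def differentiable_def by blast
qed

lemma smooth_on_dir_deriv:
  assumes "smooth_on U S f" "u \<in> U"
  shows "smooth_on U S (dir_deriv f u)"
proof (rule smooth_onI)
  fix k
  have "Ck_on (Suc k) U S f"
    using assms(1) by (rule smooth_onD)
  then show "Ck_on k U S (dir_deriv f u)"
    using assms(2) by simp
qed

lemma smooth_on_const: "open_along U S \<Longrightarrow> smooth_on U S (\<lambda>x. c)"
  by (rule smooth_onI, rule Ck_on_const) (assumption | erule smooth_onD)+

lemma smooth_on_ident: "open_along U S \<Longrightarrow> smooth_on U S (\<lambda>x. x)"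
  by (rule smooth_onI, rule Ck_on_ident) (assumption | erule smooth_onD)+

lemma smooth_on_add:
  "open_along U S \<Longrightarrow> smooth_on U S f \<Longrightarrow> smooth_on U S g \<Longrightarrow> smooth_on U S (\<lambda>x. f x + g x)"
  by (rule smooth_onI, rule Ck_on_add) (assumption | erule smooth_onD)+

lemma smooth_on_bounded_linear:
  "open_along U S \<Longrightarrow> bounded_linear h \<Longrightarrow> smooth_on U S f \<Longrightarrow> smooth_on U S (\<lambda>x. h (f x))"
  by (rule smooth_onI, rule Ck_on_bounded_linear) (assumption | erule smooth_onD)+

lemma smooth_on_bounded_bilinear:
  "open_along U S \<Longrightarrow> bounded_bilinear h \<Longrightarrow> smooth_on U S f \<Longrightarrow> smooth_on U S g
    \<Longrightarrow> smooth_on U S (\<lambda>x. h (f x) (g x))"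
  by (rule smooth_onI, rule Ck_on_bounded_bilinear) (assumption | erule smooth_onD)+

lemmas smooth_on_mult = smooth_on_bounded_bilinear[OF _ bounded_bilinear_mult]
lemmas smooth_on_scaleR = smooth_on_bounded_bilinear[OF _ bounded_bilinear_scaleR]

lemma smooth_on_component:
  "open_along U S \<Longrightarrow> smooth_on U S f \<Longrightarrow> smooth_on U S (\<lambda>x. f x $ i)"
  by (rule smooth_on_bounded_linear[OF _ bounded_linear_vec_nth])

lemma smooth_on_divide:
  fixes f :: "'a::real_normed_vector \<Rightarrow> real"
  assumes "open_along U S" "smooth_on U S f" "smooth_on U S g" "\<And>x. x \<in> S \<Longrightarrow> g x \<noteq> 0"
  shows "smooth_on U S (\<lambda>x. f x / g x)"
proof -
  have "smooth_on U S (\<lambda>x. inverse (g x))"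
    by (rule smooth_onI, rule Ck_on_inverse) (use assms smooth_onD in auto)
  then show ?thesis
    using smooth_on_mult[OF assms(1,2)] by (simp add: divide_inverse)
qed

lemma smooth_on_sum:
  assumes "open_along U S" "\<And>i. i \<in> A \<Longrightarrow> smooth_on U S (f i)"
  shows "smooth_on U S (\<lambda>x. \<Sum>i\<in>A. f i x)"
  using assms(2)
  by (induction A rule: infinite_finite_induct)
    (auto intro!: smooth_on_const smooth_on_add assms(1))

lemma smooth_on_prod:
  fixes f :: "'i \<Rightarrow> 'a::real_normed_vector \<Rightarrow> real"
  assumes "open_along U S" "\<And>i. i \<in> A \<Longrightarrow> smooth_on U S (f i)"
  shows "smooth_on U S (\<lambda>x. \<Prod>i\<in>A. f i x)"
  using assms(2)
  by (induction A rule: infinite_finite_induct)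
    (auto intro!: smooth_on_const smooth_on_mult assms(1))

lemma smooth_on_vec:
  fixes f :: "'a::real_normed_vector \<Rightarrow> real^'n"
  assumes "open_along U S" "\<And>i. smooth_on U S (\<lambda>x. f x $ i)"
  shows "smooth_on U S f"
proof -
  have "f = (\<lambda>x. \<Sum>i\<in>UNIV. f x $ i *\<^sub>R axis i 1)"
    by (auto simp: vec_eq_iff axis_def if_distrib cong: if_cong)
  moreover have "smooth_on U S (\<lambda>x. \<Sum>i\<in>UNIV. f x $ i *\<^sub>R axis i (1::real))"
    by (intro smooth_on_sum smooth_on_scaleR smooth_on_const assms)
  ultimately show ?thesis by simp
qed

lemma smooth_on_det:
  fixes A :: "'a::real_normed_vector \<Rightarrow> real^'n^'n"
  assumes "open_along U S" "\<And>i j. smooth_on U S (\<lambda>x. A x $ i $ j)"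
  shows "smooth_on U S (\<lambda>x. det (A x))"
  unfolding det_def
  by (intro smooth_on_sum smooth_on_mult smooth_on_prod smooth_on_const assms)

text \<open>By Cramer's rule, the solution of a linear system is a rational function of the data.\<close>

lemma smooth_on_linear_system:
  fixes A :: "'a::real_normed_vector \<Rightarrow> real^'n^'n"
  assumes S: "open_along U S" and A: "\<And>i j. smooth_on U S (\<lambda>x. A x $ i $ j)"
    and b: "smooth_on U S b"
    and det: "\<And>x. x \<in> S \<Longrightarrow> det (A x) \<noteq> 0" and sol: "\<And>x. x \<in> S \<Longrightarrow> A x *v y x = b x"
  shows "smooth_on U S y"
proof (rule smooth_on_vec[OF S])
  fix k
  have "smooth_on U S (\<lambda>x. det (\<chi> i j. if j = k then b x $ i else A x $ i $ j) / det (A x))"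
  proof (intro smooth_on_divide smooth_on_det S A det)
    show "smooth_on U S (\<lambda>x. (\<chi> i j. if j = k then b x $ i else A x $ i $ j) $ i $ j)" for i j
      using A smooth_on_component[OF S b] by (cases "j = k") auto
  qed
  then show "smooth_on U S (\<lambda>x. y x $ k)"
    by (rule iffD1[OF smooth_on_cong[OF S], rotated])
      (use iffD1[OF cramer[OF det] sol] in \<open>simp add: vec_eq_iff\<close>)
qed

section \<open>Calculus on the simplex and along curves\<close>

lemma open_along_prob_plus: "open_along tangent prob_plus"
  unfolding open_along_def
proof (intro ballI)
  fix x u :: "real^'n" assume x: "x \<in> prob_plus" and u: "u \<in> tangent"
  have "\<forall>\<^sub>F s in nhds 0. \<forall>i. 0 < (x + s *\<^sub>R u) $ i"
  proof (rule eventually_all_finite)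
    fix i
    have "((\<lambda>s::real. (x + s *\<^sub>R u) $ i) \<longlongrightarrow> (x + 0 *\<^sub>R u) $ i) (nhds 0)"
      by (intro tendsto_intros filterlim_ident)
    then show "\<forall>\<^sub>F s in nhds 0. 0 < (x + s *\<^sub>R u) $ i"
      using x by (intro order_tendstoD(1)) (auto simp: prob_plus_def)
  qed
  then show "\<forall>\<^sub>F s in nhds 0. x + s *\<^sub>R u \<in> prob_plus"
    by eventually_elim
      (use x u in \<open>simp add: prob_plus_def tangent_def sum.distrib flip: sum_distrib_left\<close>)
qed

lemma open_along_open:
  assumes "open S"
  shows "open_along U S"
  unfolding open_along_def
proof (intro ballI)
  fix x u assume "x \<in> S" "u \<in> U"
  have "((\<lambda>s::real. x + s *\<^sub>R u) \<longlongrightarrow> x + 0 *\<^sub>R u) (nhds 0)"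
    by (intro tendsto_intros filterlim_ident)
  then show "\<forall>\<^sub>F s in nhds 0. x + s *\<^sub>R u \<in> S"
    using assms \<open>x \<in> S\<close> by (intro topological_tendstoD) auto
qed

lemma smooth_on_has_vector_derivative:
  fixes f :: "real \<Rightarrow> 'b::real_normed_vector"
  assumes "open S" "smooth_on UNIV S f" "t \<in> S"
  shows "(f has_vector_derivative vector_derivative f (at t)) (at t)"
proof -
  obtain f' where "(f has_derivative f') (at t within S)"
    using smooth_on_has_derivative[OF assms(2,3)] .
  then have "f differentiable (at t)"
    using assms at_within_open differentiable_def by metis
  then show ?thesis
    using vector_derivative_works by blast
qed

lemma dir_deriv_real:
  fixes f :: "real \<Rightarrow> 'b::real_normed_vector"
  assumes "open S" "smooth_on UNIV S f" "t \<in> S"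
  shows "dir_deriv f 1 t = vector_derivative f (at t)"
proof -
  have "(f has_derivative (\<lambda>s. s *\<^sub>R vector_derivative f (at t))) (at t within S)"
    using smooth_on_has_vector_derivative[OF assms]
    by (simp add: has_vector_derivative_def has_derivative_at_withinI)
  from dir_deriv_eq[OF open_along_open[OF assms(1)] assms(3) _ this, where u = 1 and U = UNIV]
  show ?thesis by simp
qed

lemma smooth_on_vector_derivative:
  fixes f :: "real \<Rightarrow> 'b::real_normed_vector"
  assumes "open S" "smooth_on UNIV S f"
  shows "smooth_on UNIV S (\<lambda>t. vector_derivative f (at t))"
  by (rule iffD1[OF smooth_on_cong[OF open_along_open[OF assms(1)]]
        smooth_on_dir_deriv[OF assms(2), of 1]])
    (simp_all add: dir_deriv_real[OF assms])

text \<open>The coordinate sum is constant on the simplex and on the tangent space, so derivatives of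
  maps into either are tangent.\<close>

lemma dir_deriv_in_tangent:
  assumes "open_along U S" "smooth_on U S f" "x \<in> S" "u \<in> U"
    and "\<And>y. y \<in> S \<Longrightarrow> (\<Sum>i\<in>UNIV. f y $ i) = c"
  shows "dir_deriv f u x \<in> tangent"
proof -
  obtain f' where f': "(f has_derivative f') (at x within S)"
    using assms(2,3) by (rule smooth_on_has_derivative)
  have "((\<lambda>y. \<Sum>i\<in>UNIV. f y $ i) has_derivative (\<lambda>u. \<Sum>i\<in>UNIV. f' u $ i)) (at x within S)"
    by (intro has_derivative_sum bounded_linear.has_derivative[OF bounded_linear_vec_nth f'])
  then have "dir_deriv (\<lambda>y. \<Sum>i\<in>UNIV. f y $ i) u x = (\<Sum>i\<in>UNIV. f' u $ i)"
    by (rule dir_deriv_eq[OF assms(1,3,4)])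
  moreover have "dir_deriv (\<lambda>y. \<Sum>i\<in>UNIV. f y $ i) u x = dir_deriv (\<lambda>y. c) u x"
    by (rule dir_deriv_cong[OF assms(1) assms(5) assms(3,4)])
  ultimately show ?thesis
    by (simp add: tangent_def dir_deriv_eq[OF assms(1,3,4) f'])
qed

lemma vector_derivative_in_tangent:
  assumes "open S" "smooth_on UNIV S f" "t \<in> S"
    and "\<And>s. s \<in> S \<Longrightarrow> (\<Sum>i\<in>UNIV. f s $ i) = c"
  shows "vector_derivative f (at t) \<in> tangent"
  using dir_deriv_in_tangent[OF open_along_open[OF assms(1)] assms(2,3) UNIV_I[of 1] assms(4)]
  by (simp add: dir_deriv_real[OF assms(1-3)])

lemma dir_deriv_sum_direction:
  assumes "open_along U S" "smooth_on U S f" "x \<in> S" "finite A"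
    and "\<And>i. i \<in> A \<Longrightarrow> u i \<in> U" "(\<Sum>i\<in>A. c i *\<^sub>R u i) \<in> U"
  shows "dir_deriv f (\<Sum>i\<in>A. c i *\<^sub>R u i) x = (\<Sum>i\<in>A. c i *\<^sub>R dir_deriv f (u i) x)"
proof -
  obtain f' where f': "(f has_derivative f') (at x within S)"
    using assms(2,3) by (rule smooth_on_has_derivative)
  have "linear f'"
    using has_derivative_bounded_linear[OF f'] by (rule bounded_linear.linear)
  then have "f' (\<Sum>i\<in>A. c i *\<^sub>R u i) = (\<Sum>i\<in>A. c i *\<^sub>R f' (u i))"
    by (simp add: linear_sum linear_cmul)
  moreover have "f' (u i) = dir_deriv f (u i) x" if "i \<in> A" for i
    using dir_deriv_eq[OF assms(1,3) assms(5)[OF that] f'] by simp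
  ultimately show ?thesis
    using dir_deriv_eq[OF assms(1,3,6) f'] by simp
qed

lemma dir_deriv_add_direction:
  assumes "open_along U S" "smooth_on U S f" "x \<in> S" "u \<in> U" "v \<in> U" "u + v \<in> U"
  shows "dir_deriv f (u + v) x = dir_deriv f u x + dir_deriv f v x"
proof -
  obtain f' where f': "(f has_derivative f') (at x within S)"
    using assms(2,3) by (rule smooth_on_has_derivative)
  have "linear f'"
    using has_derivative_bounded_linear[OF f'] by (rule bounded_linear.linear)
  then show ?thesis
    using dir_deriv_eq[OF assms(1,3) _ f'] assms(4-6) by (simp add: linear_add)
qed

lemma dir_deriv_scaleR_direction:
  assumes "open_along U S" "smooth_on U S f" "x \<in> S" "u \<in> U" "c *\<^sub>R u \<in> U"
  shows "dir_deriv f (c *\<^sub>R u) x = c *\<^sub>R dir_deriv f u x"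
proof -
  obtain f' where f': "(f has_derivative f') (at x within S)"
    using assms(2,3) by (rule smooth_on_has_derivative)
  have "linear f'"
    using has_derivative_bounded_linear[OF f'] by (rule bounded_linear.linear)
  then show ?thesis
    using dir_deriv_eq[OF assms(1,3) _ f'] assms(4,5) by (simp add: linear_cmul)
qed

lemma dir_deriv_add:
  assumes "open_along U S" "smooth_on U S f" "smooth_on U S h" "x \<in> S" "u \<in> U"
  shows "dir_deriv (\<lambda>y. f y + h y) u x = dir_deriv f u x + dir_deriv h u x"
proof -
  obtain f' where f': "(f has_derivative f') (at x within S)"
    using assms(2,4) by (rule smooth_on_has_derivative)
  obtain h' where h': "(h has_derivative h') (at x within S)"
    using assms(3,4) by (rule smooth_on_has_derivative)
  show ?thesis
    using dir_deriv_eq[OF assms(1,4,5)] f' h' has_derivative_add[OF f' h'] by metis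
qed

lemma dir_deriv_scaleR:
  assumes "open_along U S" "smooth_on U S f" "smooth_on U S h" "x \<in> S" "u \<in> U"
  shows "dir_deriv (\<lambda>y. f y *\<^sub>R h y) u x = f x *\<^sub>R dir_deriv h u x + dir_deriv f u x *\<^sub>R h x"
proof -
  obtain f' where f': "(f has_derivative f') (at x within S)"
    using assms(2,4) by (rule smooth_on_has_derivative)
  obtain h' where h': "(h has_derivative h') (at x within S)"
    using assms(3,4) by (rule smooth_on_has_derivative)
  show ?thesis
    using dir_deriv_eq[OF assms(1,4,5)] f' h' has_derivative_scaleR[OF f' h'] by metis
qed

text \<open>Vectors that span the tangent space, with the coordinates of a tangent vector as its
  coefficients; the reference vertex \<^term>\<open>undefined\<close> is arbitrary.\<close>

definition tangent_generator :: "'n::finite \<Rightarrow> real^'n" where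
  "tangent_generator k = axis k 1 - axis undefined 1"

lemma subspace_tangent: "subspace tangent"
  by (auto simp: subspace_def tangent_def sum.distrib simp flip: sum_distrib_left)

lemma tangent_generator_in_tangent: "tangent_generator k \<in> tangent"
  by (simp add: tangent_generator_def tangent_def axis_def sum_subtractf)

lemma tangent_expansion:
  assumes "u \<in> tangent"
  shows "(\<Sum>k\<in>UNIV. u $ k *\<^sub>R tangent_generator k) = u"
proof -
  have "(\<Sum>k\<in>UNIV. u $ k *\<^sub>R tangent_generator k)
      = (\<Sum>k\<in>UNIV. u $ k *\<^sub>R axis k 1) - (\<Sum>k\<in>UNIV. u $ k) *\<^sub>R axis undefined 1"
    by (simp add: tangent_generator_def scaleR_diff_right sum_subtractf scaleR_sum_left)
  also have "\<dots> = u"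
    using assms basis_expansion[of u] by (simp add: tangent_def scalar_mult_eq_scaleR)
  finally show ?thesis .
qed

lemma const_in_vector_fields: "u \<in> tangent \<Longrightarrow> (\<lambda>x. u) \<in> vector_fields"
  by (simp add: vector_fields_def smooth_on_const[OF open_along_prob_plus])

lemma dir_deriv_vector_field_in_tangent:
  "X \<in> vector_fields \<Longrightarrow> \<rho> \<in> prob_plus \<Longrightarrow> u \<in> tangent \<Longrightarrow> dir_deriv X u \<rho> \<in> tangent"
  by (rule dir_deriv_in_tangent[OF open_along_prob_plus, where c = 0])
    (auto simp: vector_fields_def tangent_def)

lemma vector_derivative_curve_in_fields_along:
  assumes I: "open I" and \<rho>: "smooth_curve I \<rho>"
  shows "(\<lambda>t. vector_derivative \<rho> (at t)) \<in> fields_along I"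
  using assms smooth_on_vector_derivative[OF I, of \<rho>] vector_derivative_in_tangent[OF I, of \<rho> _ 1]
  by (auto simp: fields_along_def smooth_curve_def prob_plus_def)

lemma vector_derivative_along_curve:
  assumes I: "open I" and \<rho>: "smooth_curve I \<rho>" and X: "smooth_on tangent prob_plus X" and t: "t \<in> I"
  shows "vector_derivative (\<lambda>s. X (\<rho> s)) (at t) = dir_deriv X (vector_derivative \<rho> (at t)) (\<rho> t)"
proof -
  let ?v = "vector_derivative \<rho> (at t)"
  have P: "\<rho> s \<in> prob_plus" if "s \<in> I" for s
    using \<rho> that by (simp add: smooth_curve_def)
  have v: "?v \<in> tangent"
    using vector_derivative_curve_in_fields_along[OF I \<rho>] t by (simp add: fields_along_def)
  obtain X' where X': "(X has_derivative X') (at (\<rho> t) within prob_plus)"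
    using X P[OF t] by (rule smooth_on_has_derivative)
  have "(\<rho> has_derivative (\<lambda>s. s *\<^sub>R ?v)) (at t within I)"
    using smooth_on_has_vector_derivative[OF I _ t, of \<rho>] \<rho>
    by (simp add: smooth_curve_def has_vector_derivative_def has_derivative_at_withinI)
  moreover have "(X has_derivative X') (at (\<rho> t) within \<rho> ` I)"
    using X' by (rule has_derivative_subset) (auto simp: P)
  ultimately have "((\<lambda>s. X (\<rho> s)) has_derivative (\<lambda>s. X' (s *\<^sub>R ?v))) (at t within I)"
    by (rule has_derivative_in_compose)
  moreover have "X' (s *\<^sub>R ?v) = s *\<^sub>R X' ?v" for s
    using has_derivative_bounded_linear[OF X'] by (simp add: bounded_linear.linear linear_cmul)
  ultimately have "((\<lambda>s. X (\<rho> s)) has_vector_derivative X' ?v) (at t)"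
    by (simp only: has_vector_derivative_def at_within_open[OF t I])
  then show ?thesis
    using dir_deriv_eq[OF open_along_prob_plus P[OF t] v X'] by (simp add: vector_derivative_at)
qed

section \<open>The weighted Laplacian and its pseudo-inverse\<close>

text \<open>The product of a matrix with a pseudo-inverse is, in either order, an orthogonal projection
  whose range or kernel is that of the matrix; hence it is the same for both candidates.\<close>

lemma is_pseudo_inverse_unique:
  assumes B: "is_pseudo_inverse A B" and C: "is_pseudo_inverse A C"
  shows "B = C"
proof -
  have "A ** B = (A ** C) ** (A ** B)"
    using C by (simp add: is_pseudo_inverse_def matrix_mul_assoc)
  also have "\<dots> = transpose ((A ** B) ** (A ** C))"
    using B C by (simp add: is_pseudo_inverse_def matrix_transpose_mul)
  also have "(A ** B) ** (A ** C) = A ** C"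
    using B by (simp add: is_pseudo_inverse_def matrix_mul_assoc)
  finally have AB: "A ** B = A ** C"
    using C by (simp add: is_pseudo_inverse_def)
  have "B ** A = (B ** A) ** (C ** A)"
    using C by (simp add: is_pseudo_inverse_def flip: matrix_mul_assoc)
  also have "\<dots> = transpose ((C ** A) ** (B ** A))"
    using B C by (simp add: is_pseudo_inverse_def matrix_transpose_mul)
  also have "(C ** A) ** (B ** A) = C ** A"
    using B by (simp add: is_pseudo_inverse_def flip: matrix_mul_assoc)
  finally have BA: "B ** A = C ** A"
    using C by (simp add: is_pseudo_inverse_def)
  have "B = B ** (A ** B)"
    using B by (simp add: is_pseudo_inverse_def matrix_mul_assoc)
  also have "\<dots> = C ** A ** C"
    by (simp add: AB BA matrix_mul_assoc)
  finally show ?thesis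
    using C by (simp add: is_pseudo_inverse_def)
qed

lemma pseudo_inverse_eqI: "is_pseudo_inverse A B \<Longrightarrow> A\<^sup>\<dagger> = B"
  unfolding pseudo_inverse_def by (blast intro: is_pseudo_inverse_unique)

text \<open>The matrix of the orthogonal projection onto the constant vectors.\<close>

definition averaging :: "real^'n^'n::finite" where
  "averaging = (\<chi> i j. 1 / real CARD('n))"

lemma averaging_nth: "(averaging *v x) $ i = (\<Sum>j\<in>UNIV. x $ j) / real CARD('n)"
  for x :: "real^'n::finite"
  by (simp add: averaging_def matrix_vector_mult_def sum_divide_distrib)

lemma averaging_tangent: "x \<in> tangent \<Longrightarrow> averaging *v x = 0"
  by (simp add: vec_eq_iff averaging_nth tangent_def)

lemma averaging_idem: "averaging *v (averaging *v x) = averaging *v x"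
  by (simp add: vec_eq_iff averaging_nth)

context
  fixes E :: "('n::finite \<times> 'n) set" and \<omega> :: "'n \<Rightarrow> 'n \<Rightarrow> real"
  assumes graph: "connected_weighted_graph E \<omega>"
begin

abbreviation (input) L where "L \<equiv> laplacian E \<omega>"
abbreviation (input) grad_prod where "grad_prod x y \<equiv> field_prod E (graph_grad \<omega> x) (graph_grad \<omega> y)"

lemma weight_commute: "\<omega> i j = \<omega> j i"
  using graph by (simp add: connected_weighted_graph_def)

lemma weight_nonneg: "\<omega> i j \<ge> 0"
  using graph unfolding connected_weighted_graph_def by (metis order.refl order_less_imp_le)

lemma weight_eq_0: "j \<notin> neighbours E i \<Longrightarrow> \<omega> i j = 0"
  using graph unfolding connected_weighted_graph_def neighbours_def by (metis mem_Collect_eq)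

lemma sum_neighbours: "(\<Sum>j\<in>neighbours E i. \<omega> i j * h j) = (\<Sum>j\<in>UNIV. \<omega> i j * h j)"
  by (rule sum.mono_neutral_left) (auto simp: weight_eq_0)

lemma laplacian_nth:
  "(L a *v x) $ i = (\<Sum>j\<in>UNIV. \<omega> i j * (edge_mean a i j * (x $ i - x $ j)))"
proof -
  have "Vector_Spaces.linear (*s) (*s)
      (\<lambda>\<Phi>::real^'n. (\<chi> i. \<Sum>j\<in>neighbours E i. \<omega> i j * edge_mean a i j * (\<Phi> $ i - \<Phi> $ j)) :: real^'n)"
    by unfold_locales
      (auto simp: vec_eq_iff sum_distrib_left algebra_simps simp flip: sum.distrib)
  then show ?thesis
    by (simp add: laplacian_def matrix_works mult.assoc sum_neighbours)
qed

lemma grad_prod_nth: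
  "grad_prod x y $ i = (1/2) * (\<Sum>j\<in>UNIV. \<omega> i j * ((x $ i - x $ j) * (y $ i - y $ j)))"
proof -
  have "sqrt (\<omega> i j) * (x $ i - x $ j) * (sqrt (\<omega> i j) * (y $ i - y $ j))
      = \<omega> i j * ((x $ i - x $ j) * (y $ i - y $ j))" for j
  proof -
    have "sqrt (\<omega> i j) * (x $ i - x $ j) * (sqrt (\<omega> i j) * (y $ i - y $ j))
        = (sqrt (\<omega> i j) * sqrt (\<omega> i j)) * ((x $ i - x $ j) * (y $ i - y $ j))"
      by (simp only: mult_ac)
    then show ?thesis
      using weight_nonneg[of i j] by simp
  qed
  then show ?thesis
    unfolding field_prod_def graph_grad_def by (simp only: sum_neighbours vec_lambda_beta)
qed

lemma grad_prod_commute: "grad_prod x y = grad_prod y x"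
  by (simp add: vec_eq_iff grad_prod_nth mult.commute)

lemma bounded_bilinear_laplacian: "bounded_bilinear (\<lambda>a x. L a *v x)"
  by (rule iffD1[OF bilinear_conv_bounded_bilinear])
    (auto simp: bilinear_def linear_iff vec_eq_iff laplacian_nth edge_mean_def sum_distrib_left
      algebra_simps add_divide_distrib simp flip: sum.distrib)

lemma bounded_bilinear_grad_prod: "bounded_bilinear (\<lambda>x y. grad_prod x y)"
  by (rule iffD1[OF bilinear_conv_bounded_bilinear])
    (auto simp: bilinear_def linear_iff vec_eq_iff grad_prod_nth sum_distrib_left
      algebra_simps simp flip: sum.distrib)

text \<open>Discrete integration by parts, read as a function of the weight vector: the energy form
  of \<^term>\<open>L a\<close> is linear in \<^term>\<open>a\<close> with coefficients \<^term>\<open>grad_prod x y\<close>.  This duality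
  turns the differential of the metric into the last term of the transport equation.\<close>

lemma inner_laplacian: "x \<bullet> (L a *v y) = a \<bullet> grad_prod x y"
proof -
  let ?t = "\<lambda>i j. (x $ i - x $ j) * (y $ i - y $ j)"
  have "x \<bullet> (L a *v y) = (\<Sum>i\<in>UNIV. \<Sum>j\<in>UNIV. \<omega> i j * (edge_mean a i j * (x $ i * (y $ i - y $ j))))"
    (is "_ = ?A")
    by (simp add: inner_vec_def laplacian_nth sum_distrib_left algebra_simps)
  moreover have "?A = (\<Sum>i\<in>UNIV. \<Sum>j\<in>UNIV. \<omega> i j * (edge_mean a i j * (x $ j * (y $ j - y $ i))))"
    (is "_ = ?A'")
    by (subst sum.swap) (simp add: weight_commute edge_mean_def add.commute)
  ultimately have "2 * (x \<bullet> (L a *v y)) = ?A + ?A'"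
    by linarith
  also have "\<dots> = (\<Sum>i\<in>UNIV. \<Sum>j\<in>UNIV. \<omega> i j * (edge_mean a i j * ?t i j))"
    unfolding sum.distrib[symmetric] by (intro sum.cong refl) (simp add: algebra_simps)
  finally have A: "2 * (x \<bullet> (L a *v y)) = \<dots>" .
  have "2 * (a \<bullet> grad_prod x y) = (\<Sum>i\<in>UNIV. \<Sum>j\<in>UNIV. \<omega> i j * (a $ i * ?t i j))" (is "_ = ?B")
    by (simp add: inner_vec_def grad_prod_nth sum_distrib_left algebra_simps)
  moreover have "?B = (\<Sum>i\<in>UNIV. \<Sum>j\<in>UNIV. \<omega> i j * (a $ j * ?t i j))"
    by (subst sum.swap) (simp add: weight_commute algebra_simps)
  ultimately have "2 * (2 * (a \<bullet> grad_prod x y))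
      = (\<Sum>i\<in>UNIV. \<Sum>j\<in>UNIV. \<omega> i j * (a $ i * ?t i j)) + (\<Sum>i\<in>UNIV. \<Sum>j\<in>UNIV. \<omega> i j * (a $ j * ?t i j))"
    by linarith
  also have "\<dots> = 2 * (\<Sum>i\<in>UNIV. \<Sum>j\<in>UNIV. \<omega> i j * (edge_mean a i j * ?t i j))"
    unfolding sum_distrib_left sum.distrib[symmetric] edge_mean_def
    by (intro sum.cong refl) (simp add: field_simps)
  finally show ?thesis
    using A by simp
qed

lemma inner_laplacian_commute: "(L a *v x) \<bullet> y = x \<bullet> (L a *v y)"
  by (metis inner_commute inner_laplacian grad_prod_commute)

lemma laplacian_constant: "L a *v (\<chi> i. c) = 0"
  by (simp add: vec_eq_iff laplacian_nth)

lemma laplacian_in_tangent: "L a *v x \<in> tangent"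
proof -
  have "(L a *v x) \<bullet> (\<chi> i. 1) = 0"
    unfolding inner_laplacian_commute laplacian_constant by simp
  then show ?thesis
    by (simp add: tangent_def inner_vec_def)
qed

lemma laplacian_averaging: "L a *v (averaging *v x) = 0"
  using laplacian_constant by (simp add: vec_eq_iff laplacian_nth averaging_nth)

text \<open>For a positive density the energy vanishes on constants only, by connectedness; adding
  the projection onto the constants removes this kernel.\<close>

lemma invertible_laplacian_averaging:
  assumes "\<rho> \<in> prob_plus"
  shows "invertible (L \<rho> + averaging)"
proof -
  have "x = 0" if "(L \<rho> + averaging) *v x = 0" for x
  proof -
    have eq: "L \<rho> *v x + averaging *v x = 0"
      using that by (simp add: matrix_vector_mult_add_rdistrib)
    have "averaging *v x = averaging *v (L \<rho> *v x + averaging *v x)"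
      by (simp add: matrix_vector_right_distrib averaging_idem averaging_tangent laplacian_in_tangent)
    then have avg: "averaging *v x = 0"
      using eq by simp
    then have "\<rho> \<bullet> grad_prod x x = 0"
      using eq by (simp flip: inner_laplacian)
    then have "(\<Sum>i\<in>UNIV. \<rho> $ i * (\<Sum>j\<in>UNIV. \<omega> i j * (x $ i - x $ j)\<^sup>2)) = 0"
      by (simp add: inner_vec_def grad_prod_nth power2_eq_square flip: sum_divide_distrib)
    moreover have nn: "\<omega> i j * (x $ i - x $ j)\<^sup>2 \<ge> 0" for i j
      by (simp add: weight_nonneg)
    moreover have pos: "\<rho> $ i > 0" for i
      using assms by (simp add: prob_plus_def)
    moreover have "\<rho> $ i * (\<Sum>j\<in>UNIV. \<omega> i j * (x $ i - x $ j)\<^sup>2) \<ge> 0" for i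
      using pos[of i] by (auto intro!: mult_nonneg_nonneg sum_nonneg simp: weight_nonneg)
    ultimately have prod_zero: "\<rho> $ i * (\<Sum>j\<in>UNIV. \<omega> i j * (x $ i - x $ j)\<^sup>2) = 0" for i
      by (subst (asm) sum_nonneg_eq_0_iff) auto
    have zero: "\<omega> i j * (x $ i - x $ j)\<^sup>2 = 0" for i j
    proof -
      have "(\<Sum>j\<in>UNIV. \<omega> i j * (x $ i - x $ j)\<^sup>2) = 0"
        using prod_zero[of i] pos[of i] by (simp only: mult_eq_0_iff) auto
      then show ?thesis
        using nn by (subst (asm) sum_nonneg_eq_0_iff) auto
    qed
    have edge: "x $ i = x $ j" if "(i, j) \<in> E" for i j
    proof -
      have "\<omega> i j > 0"
        using that graph unfolding connected_weighted_graph_def by presburger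
      then show ?thesis
        using zero[of i j] by simp
    qed
    have const: "x $ i = x $ j" for i j
    proof -
      have "(i, j) \<in> E\<^sup>*"
        using graph by (simp add: connected_weighted_graph_def)
      then show ?thesis
        by induction (auto dest: edge)
    qed
    have "x $ i = 0" for i
    proof -
      have "(\<Sum>j\<in>UNIV. x $ j) = (\<Sum>j\<in>(UNIV::'n set). x $ i)"
        by (rule sum.cong) (auto intro: const)
      then show ?thesis
        using avg averaging_nth[of x i] by simp
    qed
    then show ?thesis
      by (simp add: vec_eq_iff)
  qed
  then show ?thesis
    by (simp add: invertible_left_inverse matrix_left_invertible_ker)
qed

lemma averaging_symmetric: "transpose (mat 1 - averaging) = mat 1 - (averaging :: real^'n^'n)"
  by (simp add: vec_eq_iff transpose_def averaging_def mat_def)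

text \<open>The pseudo-inverse is the inverse of the Laplacian plus the projection onto the constants,
  minus this projection, which vanishes on tangent vectors.  Hence \<^term>\<open>(L \<rho>)\<^sup>\<dagger> *v \<sigma>\<close> solves a
  regular linear system.\<close>

lemma laplacian_pseudo_inverse:
  assumes "\<rho> \<in> prob_plus" and "\<sigma> \<in> tangent"
  shows "(L \<rho> + averaging) *v ((L \<rho>)\<^sup>\<dagger> *v \<sigma>) = \<sigma>" and "L \<rho> *v ((L \<rho>)\<^sup>\<dagger> *v \<sigma>) = \<sigma>"
proof -
  obtain N where N: "(L \<rho> + averaging) ** N = mat 1" "N ** (L \<rho> + averaging) = mat 1"
    using invertible_laplacian_averaging[OF assms(1)] by (auto simp: invertible_def)
  let ?B = "N - averaging"
  have MN: "L \<rho> *v (N *v x) + averaging *v (N *v x) = x" for x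
    by (metis N(1) matrix_vector_mul_assoc matrix_vector_mul_lid matrix_vector_mult_add_rdistrib)
  have NM: "N *v (L \<rho> *v x) + N *v (averaging *v x) = x" for x
    by (metis N(2) matrix_vector_mul_assoc matrix_vector_mul_lid matrix_vector_mult_add_rdistrib
        matrix_vector_right_distrib)
  have avg_L: "averaging *v (L \<rho> *v x) = 0" for x
    by (simp add: averaging_tangent laplacian_in_tangent)
  have N_avg: "N *v (averaging *v x) = averaging *v x" for x
    using NM[of "averaging *v x"] by (simp add: laplacian_averaging averaging_idem)
  have avg_N: "averaging *v (N *v x) = averaging *v x" for x
    using arg_cong[OF MN[of x], of "(*v) averaging"]
    by (simp add: matrix_vector_right_distrib avg_L averaging_idem)
  have LB: "L \<rho> ** ?B = mat 1 - averaging"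
    using MN by (simp add: matrix_eq algebra_simps laplacian_averaging avg_N
        flip: matrix_vector_mul_assoc)
  have BL: "?B ** L \<rho> = mat 1 - averaging"
    using NM by (simp add: matrix_eq algebra_simps avg_L N_avg
        flip: matrix_vector_mul_assoc)
  have "L \<rho> ** ?B ** L \<rho> = L \<rho>"
    unfolding LB by (simp add: matrix_eq algebra_simps avg_L flip: matrix_vector_mul_assoc)
  moreover have "?B ** L \<rho> ** ?B = ?B"
    unfolding BL
    by (simp add: matrix_eq algebra_simps averaging_idem avg_N flip: matrix_vector_mul_assoc)
  ultimately have "(L \<rho>)\<^sup>\<dagger> = ?B"
    by (intro pseudo_inverse_eqI) (simp add: is_pseudo_inverse_def LB BL averaging_symmetric)
  then have eq: "(L \<rho>)\<^sup>\<dagger> *v \<sigma> = N *v \<sigma>"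
    using assms(2) by (simp add: matrix_vector_mult_diff_rdistrib averaging_tangent)
  show "(L \<rho> + averaging) *v ((L \<rho>)\<^sup>\<dagger> *v \<sigma>) = \<sigma>"
    using MN by (simp add: eq matrix_vector_mult_add_rdistrib)
  show "L \<rho> *v ((L \<rho>)\<^sup>\<dagger> *v \<sigma>) = \<sigma>"
    using MN[of \<sigma>] by (simp add: eq avg_N averaging_tangent[OF assms(2)])
qed

lemma smooth_on_laplacian_pseudo_inverse:
  assumes S: "open_along U S" and "smooth_on U S \<rho>" "smooth_on U S \<sigma>"
    and "\<And>x. x \<in> S \<Longrightarrow> \<rho> x \<in> prob_plus" "\<And>x. x \<in> S \<Longrightarrow> \<sigma> x \<in> tangent"
  shows "smooth_on U S (\<lambda>x. (L (\<rho> x))\<^sup>\<dagger> *v \<sigma> x)"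
proof (rule smooth_on_linear_system[OF S _ assms(3)])
  show "smooth_on U S (\<lambda>x. (L (\<rho> x) + averaging) $ i $ j)" for i j
  proof -
    have "(L (\<rho> x) + averaging) $ i $ j = (L (\<rho> x) *v axis j 1) $ i + averaging $ i $ j" for x
      by (simp add: matrix_vector_mult_basis column_def)
    moreover have "smooth_on U S (\<lambda>x. (L (\<rho> x) *v axis j 1) $ i + averaging $ i $ j)"
      by (intro smooth_on_add smooth_on_component smooth_on_const
          smooth_on_bounded_bilinear[OF S bounded_bilinear_laplacian] assms)
    ultimately show ?thesis by simp
  qed
  show "det (L (\<rho> x) + averaging) \<noteq> 0" if "x \<in> S" for x
    using invertible_laplacian_averaging assms(4)[OF that] invertible_det_nz by blast
  show "(L (\<rho> x) + averaging) *v ((L (\<rho> x))\<^sup>\<dagger> *v \<sigma> x) = \<sigma> x" if "x \<in> S" for x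
    by (rule laplacian_pseudo_inverse) (use assms that in auto)
qed

section \<open>The Wasserstein metric and its Christoffel symbols\<close>

abbreviation (input) g where "g \<equiv> wasserstein_metric E \<omega>"

lemma bilinear_metric: "bilinear (g \<rho>)"
  by (simp add: bilinear_def linear_iff wasserstein_metric_def inner_simps
      matrix_vector_right_distrib matrix_vector_mult_scaleR)

text \<open>A Laplacian in one argument cancels the pseudo-inverse in the metric.  The further properties
  of the metric rest on this, tangent vectors being Laplacians of their potentials.\<close>

lemma metric_laplacian: "\<rho> \<in> prob_plus \<Longrightarrow> w \<in> tangent \<Longrightarrow> g \<rho> (L \<rho> *v x) w = x \<bullet> w"
  by (simp add: wasserstein_metric_def inner_laplacian_commute laplacian_pseudo_inverse(2))

lemma metric_commute:
  assumes "\<rho> \<in> prob_plus" "v \<in> tangent" "w \<in> tangent"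
  shows "g \<rho> v w = g \<rho> w v"
proof -
  have "g \<rho> v w = g \<rho> (L \<rho> *v ((L \<rho>)\<^sup>\<dagger> *v v)) w"
    using assms by (simp add: laplacian_pseudo_inverse(2))
  also have "\<dots> = ((L \<rho>)\<^sup>\<dagger> *v v) \<bullet> w"
    by (rule metric_laplacian[OF assms(1,3)])
  finally show ?thesis
    by (simp add: wasserstein_metric_def inner_commute)
qed

lemma metric_nondegenerate:
  assumes "\<rho> \<in> prob_plus" "v \<in> tangent" "\<And>w. w \<in> tangent \<Longrightarrow> g \<rho> v w = 0"
  shows "v = 0"
proof -
  \<comment> \<open>Tested against \<^term>\<open>L \<rho> *v v\<close>, the metric gives the Euclidean square of \<^term>\<open>v\<close>.\<close>
  have "v \<bullet> v = g \<rho> v (L \<rho> *v v)"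
    using metric_laplacian[OF assms(1,2)] metric_commute[OF assms(1,2) laplacian_in_tangent] by simp
  then show ?thesis
    using assms(3)[OF laplacian_in_tangent] by simp
qed

text \<open>The difference between the Levi-Civita connection and the flat derivative of the
  ambient space.\<close>

definition christoffel :: "real^'n \<Rightarrow> real^'n \<Rightarrow> real^'n \<Rightarrow> real^'n" where
  "christoffel \<rho> u v =
     (1/2) *\<^sub>R (L \<rho> *v grad_prod ((L \<rho>)\<^sup>\<dagger> *v u) ((L \<rho>)\<^sup>\<dagger> *v v))
     - (1/2) *\<^sub>R (L v *v ((L \<rho>)\<^sup>\<dagger> *v u) + L u *v ((L \<rho>)\<^sup>\<dagger> *v v))"

lemma christoffel_commute: "christoffel \<rho> u v = christoffel \<rho> v u"
  by (simp add: christoffel_def grad_prod_commute add.commute)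

text \<open>On the diagonal the two Laplacian terms coincide, which is why the geodesic equation has
  one term without the factor one half.\<close>

lemma christoffel_self:
  "christoffel \<rho> u u = (1/2) *\<^sub>R (L \<rho> *v grad_prod ((L \<rho>)\<^sup>\<dagger> *v u) ((L \<rho>)\<^sup>\<dagger> *v u)) - L u *v ((L \<rho>)\<^sup>\<dagger> *v u)"
  by (simp add: christoffel_def flip: scaleR_2)

lemma christoffel_in_tangent: "christoffel \<rho> u v \<in> tangent"
  unfolding christoffel_def
  by (intro subspace_diff subspace_add subspace_scale subspace_tangent laplacian_in_tangent)

lemma bilinear_christoffel: "bilinear (christoffel \<rho>)"
  by (simp add: bilinear_def linear_iff christoffel_def
      matrix_vector_right_distrib matrix_vector_mult_scaleR
      bounded_bilinear.add_left[OF bounded_bilinear_laplacian]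
      bounded_bilinear.add_right[OF bounded_bilinear_laplacian]
      bounded_bilinear.scaleR_left[OF bounded_bilinear_laplacian]
      bounded_bilinear.scaleR_right[OF bounded_bilinear_laplacian]
      bounded_bilinear.add_left[OF bounded_bilinear_grad_prod]
      bounded_bilinear.add_right[OF bounded_bilinear_grad_prod]
      bounded_bilinear.scaleR_left[OF bounded_bilinear_grad_prod]
      bounded_bilinear.scaleR_right[OF bounded_bilinear_grad_prod]
      algebra_simps)

lemma smooth_on_christoffel:
  assumes S: "open_along U S" and \<rho>: "smooth_on U S \<rho>" "\<And>x. x \<in> S \<Longrightarrow> \<rho> x \<in> prob_plus"
    and u: "smooth_on U S u" "\<And>x. x \<in> S \<Longrightarrow> u x \<in> tangent"
    and v: "smooth_on U S v" "\<And>x. x \<in> S \<Longrightarrow> v x \<in> tangent"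
  shows "smooth_on U S (\<lambda>x. christoffel (\<rho> x) (u x) (v x))"
proof -
  note pot = smooth_on_laplacian_pseudo_inverse[OF S \<rho>(1) _ \<rho>(2)]
  note lap = smooth_on_bounded_bilinear[OF S bounded_bilinear_laplacian]
  note scale = smooth_on_bounded_linear[OF S bounded_linear_scaleR_right]
  have "smooth_on U S (\<lambda>x. (1/2) *\<^sub>R (L (\<rho> x) *v
      grad_prod ((L (\<rho> x))\<^sup>\<dagger> *v u x) ((L (\<rho> x))\<^sup>\<dagger> *v v x)))"
    by (intro scale lap smooth_on_bounded_bilinear[OF S bounded_bilinear_grad_prod] pot \<rho> u v)
  moreover have "smooth_on U S (\<lambda>x. (- 1/2) *\<^sub>R (L (v x) *v ((L (\<rho> x))\<^sup>\<dagger> *v u x)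
      + L (u x) *v ((L (\<rho> x))\<^sup>\<dagger> *v v x)))"
    by (intro scale lap smooth_on_add[OF S] pot \<rho> u v)
  ultimately show ?thesis
    using smooth_on_add[OF S] unfolding christoffel_def by fastforce
qed

text \<open>The right-hand side is the Koszul expression for constant fields: by \<open>inner_laplacian\<close> each
  term is an energy form weighted by one of the three vectors, and minus such a form is
  the derivative of the metric in the direction of that vector.\<close>

lemma metric_christoffel:
  assumes \<rho>: "\<rho> \<in> prob_plus" and w: "w \<in> tangent"
  shows "g \<rho> (christoffel \<rho> u v) w = (1/2) *
    (w \<bullet> grad_prod ((L \<rho>)\<^sup>\<dagger> *v u) ((L \<rho>)\<^sup>\<dagger> *v v)
     - v \<bullet> grad_prod ((L \<rho>)\<^sup>\<dagger> *v u) ((L \<rho>)\<^sup>\<dagger> *v w)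
     - u \<bullet> grad_prod ((L \<rho>)\<^sup>\<dagger> *v v) ((L \<rho>)\<^sup>\<dagger> *v w))"
proof -
  have "g \<rho> (L a *v x) w = a \<bullet> grad_prod x ((L \<rho>)\<^sup>\<dagger> *v w)" for a x
    by (simp add: wasserstein_metric_def inner_laplacian_commute inner_laplacian)
  then show ?thesis
    unfolding christoffel_def
    using metric_laplacian[OF \<rho> w]
    by (simp add: bilinear_lsub[OF bilinear_metric] bilinear_ladd[OF bilinear_metric]
        bilinear_lmul[OF bilinear_metric] inner_commute algebra_simps)
qed

text \<open>Exchanging \<^term>\<open>v\<close> and \<^term>\<open>w\<close> in the Koszul expression changes the sign of the terms
  weighted by these vectors and preserves the one weighted by \<^term>\<open>u\<close>.\<close>

lemma metric_christoffel_compatible: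
  assumes "\<rho> \<in> prob_plus" "v \<in> tangent" "w \<in> tangent"
  shows "g \<rho> (christoffel \<rho> u v) w + g \<rho> v (christoffel \<rho> u w)
    = - (u \<bullet> grad_prod ((L \<rho>)\<^sup>\<dagger> *v v) ((L \<rho>)\<^sup>\<dagger> *v w))"
  using metric_christoffel[OF assms(1,3), of u v] metric_christoffel[OF assms(1,2), of u w]
    metric_commute[OF assms(1,2) christoffel_in_tangent, of \<rho> u w]
  by (simp add: grad_prod_commute algebra_simps)

text \<open>The potential of \<^term>\<open>Z\<close> is known to be differentiable, so its derivative need not be computed
  from that of the pseudo-inverse: differentiating the equation \<open>L x *v \<Phi> x = Z x\<close> determines its
  image under \<^term>\<open>L \<rho>\<close>, and the metric only sees this image.\<close>

lemma dir_deriv_metric: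
  assumes Y: "Y \<in> vector_fields" and Z: "Z \<in> vector_fields"
    and \<rho>: "\<rho> \<in> prob_plus" and u: "u \<in> tangent"
  shows "dir_deriv (\<lambda>x. g x (Y x) (Z x)) u \<rho>
    = g \<rho> (dir_deriv Y u \<rho>) (Z \<rho>) + g \<rho> (Y \<rho>) (dir_deriv Z u \<rho>)
      - u \<bullet> grad_prod ((L \<rho>)\<^sup>\<dagger> *v Y \<rho>) ((L \<rho>)\<^sup>\<dagger> *v Z \<rho>)"
proof -
  note open_P = open_along_prob_plus
  let ?\<Phi> = "\<lambda>x. (L x)\<^sup>\<dagger> *v Z x" and ?\<Psi> = "(L \<rho>)\<^sup>\<dagger> *v Y \<rho>"
  have "smooth_on tangent prob_plus ?\<Phi>"
    by (rule smooth_on_laplacian_pseudo_inverse[OF open_P])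
      (use Z in \<open>auto simp: vector_fields_def intro: smooth_on_ident[OF open_P]\<close>)
  then obtain \<Phi>' where \<Phi>': "(?\<Phi> has_derivative \<Phi>') (at \<rho> within prob_plus)"
    using \<rho> by (rule smooth_on_has_derivative)
  obtain Y' where Y': "(Y has_derivative Y') (at \<rho> within prob_plus)"
    using Y \<rho> by (auto simp: vector_fields_def elim: smooth_on_has_derivative)
  have Z': "dir_deriv Z u \<rho> = L \<rho> *v \<Phi>' u + L u *v ?\<Phi> \<rho>"
  proof -
    have "dir_deriv Z u \<rho> = dir_deriv (\<lambda>x. L x *v ?\<Phi> x) u \<rho>"
      by (rule dir_deriv_cong[OF open_P _ \<rho> u])
        (use Z in \<open>simp add: vector_fields_def laplacian_pseudo_inverse(2)\<close>)
    also have "\<dots> = L \<rho> *v \<Phi>' u + L u *v ?\<Phi> \<rho>"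
      by (rule dir_deriv_eq[OF open_P \<rho> u])
        (rule bounded_bilinear.FDERIV[OF bounded_bilinear_laplacian has_derivative_ident \<Phi>'])
    finally show ?thesis .
  qed
  have Y\<rho>: "L \<rho> *v ?\<Psi> = Y \<rho>" and dZ: "dir_deriv Z u \<rho> \<in> tangent"
    using Y dir_deriv_vector_field_in_tangent[OF Z \<rho> u]
    by (simp_all add: vector_fields_def laplacian_pseudo_inverse(2) \<rho>)
  have "dir_deriv (\<lambda>x. g x (Y x) (Z x)) u \<rho> = Y \<rho> \<bullet> \<Phi>' u + Y' u \<bullet> ?\<Phi> \<rho>"
    unfolding wasserstein_metric_def
    by (rule dir_deriv_eq[OF open_P \<rho> u]) (rule has_derivative_inner[OF Y' \<Phi>'])
  also have "Y \<rho> \<bullet> \<Phi>' u = ?\<Psi> \<bullet> (L \<rho> *v \<Phi>' u)"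
    using inner_laplacian_commute[of \<rho> ?\<Psi> "\<Phi>' u"] by (simp only: Y\<rho>)
  also have "L \<rho> *v \<Phi>' u = dir_deriv Z u \<rho> - L u *v ?\<Phi> \<rho>"
    by (simp add: Z')
  also have "?\<Psi> \<bullet> (dir_deriv Z u \<rho> - L u *v ?\<Phi> \<rho>) = g \<rho> (Y \<rho>) (dir_deriv Z u \<rho>) - u \<bullet> grad_prod ?\<Psi> (?\<Phi> \<rho>)"
    using metric_laplacian[OF \<rho> dZ, of ?\<Psi>] by (simp add: Y\<rho> inner_diff_right inner_laplacian)
  also have "Y' u = dir_deriv Y u \<rho>"
    by (rule dir_deriv_eq[OF open_P \<rho> u Y', symmetric])
  finally show ?thesis
    by (simp add: wasserstein_metric_def)
qed

section \<open>The Levi-Civita connection\<close>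

definition wasserstein_connection :: "'n field \<Rightarrow> 'n field \<Rightarrow> 'n field" where
  "wasserstein_connection X Y = (\<lambda>\<rho>. dir_deriv Y (X \<rho>) \<rho> + christoffel \<rho> (X \<rho>) (Y \<rho>))"

lemma wasserstein_connection_in_vector_fields:
  assumes X: "X \<in> vector_fields" and Y: "Y \<in> vector_fields"
  shows "wasserstein_connection X Y \<in> vector_fields"
proof -
  note open_P = open_along_prob_plus
  have sX: "smooth_on tangent prob_plus X" and sY: "smooth_on tangent prob_plus Y"
    and tX: "\<And>\<rho>. \<rho> \<in> prob_plus \<Longrightarrow> X \<rho> \<in> tangent" and tY: "\<And>\<rho>. \<rho> \<in> prob_plus \<Longrightarrow> Y \<rho> \<in> tangent"
    using X Y by (auto simp: vector_fields_def)
  \<comment> \<open>Smoothness of \<^term>\<open>Y\<close> concerns derivatives in constant directions only, hence the expansion.\<close>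
  have "smooth_on tangent prob_plus
      (\<lambda>\<rho>. \<Sum>k\<in>UNIV. X \<rho> $ k *\<^sub>R dir_deriv Y (tangent_generator k) \<rho>)"
    by (intro smooth_on_sum[OF open_P] smooth_on_scaleR[OF open_P] smooth_on_component[OF open_P]
        smooth_on_dir_deriv sX sY tangent_generator_in_tangent)
  moreover have "(\<Sum>k\<in>UNIV. X \<rho> $ k *\<^sub>R dir_deriv Y (tangent_generator k) \<rho>) = dir_deriv Y (X \<rho>) \<rho>"
    if "\<rho> \<in> prob_plus" for \<rho>
    using dir_deriv_sum_direction[OF open_P sY that, of UNIV tangent_generator "\<lambda>k. X \<rho> $ k"]
    by (simp add: tangent_expansion[OF tX[OF that]] tangent_generator_in_tangent tX[OF that])
  ultimately have "smooth_on tangent prob_plus (\<lambda>\<rho>. dir_deriv Y (X \<rho>) \<rho>)"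
    by (rule iffD1[OF smooth_on_cong[OF open_P], rotated])
  moreover have "smooth_on tangent prob_plus (\<lambda>\<rho>. christoffel \<rho> (X \<rho>) (Y \<rho>))"
    by (rule smooth_on_christoffel[OF open_P smooth_on_ident[OF open_P] _ sX tX sY tY])
  ultimately have "smooth_on tangent prob_plus (wasserstein_connection X Y)"
    unfolding wasserstein_connection_def by (rule smooth_on_add[OF open_P])
  moreover have "wasserstein_connection X Y \<rho> \<in> tangent" if "\<rho> \<in> prob_plus" for \<rho>
    unfolding wasserstein_connection_def
    by (intro subspace_add[OF subspace_tangent] christoffel_in_tangent
        dir_deriv_vector_field_in_tangent Y that tX)
  ultimately show ?thesis
    by (simp add: vector_fields_def)
qed

lemma affine_connection_wasserstein: "affine_connection wasserstein_connection"
  unfolding affine_connection_def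
proof (intro conjI ballI impI)
  note open_P = open_along_prob_plus
  note defs = wasserstein_connection_def bilinear_ladd[OF bilinear_christoffel]
    bilinear_radd[OF bilinear_christoffel] bilinear_lmul[OF bilinear_christoffel]
    bilinear_rmul[OF bilinear_christoffel]
  fix X X' Y Y' :: "'n field" and f :: "real^'n \<Rightarrow> real"
  assume XY: "X \<in> vector_fields" "Y \<in> vector_fields"
  then have smooth: "smooth_on tangent prob_plus X" "smooth_on tangent prob_plus Y"
    by (auto simp: vector_fields_def)
  show "wasserstein_connection X Y \<in> vector_fields"
    by (rule wasserstein_connection_in_vector_fields[OF XY])
  fix \<rho> :: "real^'n" assume \<rho>: "\<rho> \<in> prob_plus"
  have tangent: "X \<rho> \<in> tangent"
    using XY \<rho> by (auto simp: vector_fields_def)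
  show "wasserstein_connection X Y \<rho> = wasserstein_connection X' Y' \<rho>"
    if "\<forall>\<rho>\<in>prob_plus. X \<rho> = X' \<rho> \<and> Y \<rho> = Y' \<rho>"
    using that \<rho> tangent dir_deriv_cong[OF open_P, of Y Y' \<rho> "X \<rho>"]
    by (auto simp: wasserstein_connection_def)
  show "wasserstein_connection (\<lambda>x. X x + X' x) Y \<rho>
      = wasserstein_connection X Y \<rho> + wasserstein_connection X' Y \<rho>"
    if "X' \<in> vector_fields"
  proof -
    have "X' \<rho> \<in> tangent" using that \<rho> by (auto simp: vector_fields_def)
    then show ?thesis
      using dir_deriv_add_direction[OF open_P smooth(2) \<rho> tangent, of "X' \<rho>"]
        subspace_add[OF subspace_tangent tangent] by (simp add: defs)
  qed
  show "wasserstein_connection X (\<lambda>x. Y x + Y' x) \<rho>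
      = wasserstein_connection X Y \<rho> + wasserstein_connection X Y' \<rho>"
    if "Y' \<in> vector_fields"
  proof -
    have "smooth_on tangent prob_plus Y'" using that by (auto simp: vector_fields_def)
    then show ?thesis
      using dir_deriv_add[OF open_P smooth(2) _ \<rho> tangent, of Y'] by (simp add: defs)
  qed
  assume "f \<in> smooth_functions"
  then have f: "smooth_on tangent prob_plus f"
    by (simp add: smooth_functions_def)
  show "wasserstein_connection (\<lambda>x. f x *\<^sub>R X x) Y \<rho> = f \<rho> *\<^sub>R wasserstein_connection X Y \<rho>"
    using dir_deriv_scaleR_direction[OF open_P smooth(2) \<rho> tangent, of "f \<rho>"]
      subspace_scale[OF subspace_tangent tangent]
    by (simp add: defs scaleR_add_right)
  show "wasserstein_connection X (\<lambda>x. f x *\<^sub>R Y x) \<rho>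
      = f \<rho> *\<^sub>R wasserstein_connection X Y \<rho> + dir_deriv f (X \<rho>) \<rho> *\<^sub>R Y \<rho>"
    using dir_deriv_scaleR[OF open_P f smooth(2) \<rho> tangent]
    by (simp add: defs scaleR_add_right)
qed

lemma levi_civita_wasserstein: "levi_civita g wasserstein_connection"
  unfolding levi_civita_def
proof (intro conjI ballI affine_connection_wasserstein)
  fix X Y :: "'n field" and \<rho> :: "real^'n"
  show "wasserstein_connection X Y \<rho> - wasserstein_connection Y X \<rho> = lie_bracket X Y \<rho>"
    by (simp add: wasserstein_connection_def lie_bracket_def christoffel_commute[of \<rho> "X \<rho>"])
next
  fix X Y Z :: "'n field" and \<rho> :: "real^'n"
  assume X: "X \<in> vector_fields" and Y: "Y \<in> vector_fields" and Z: "Z \<in> vector_fields"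
    and \<rho>: "\<rho> \<in> prob_plus"
  then have "X \<rho> \<in> tangent" "Y \<rho> \<in> tangent" "Z \<rho> \<in> tangent"
    by (auto simp: vector_fields_def)
  then show "dir_deriv (\<lambda>x. g x (Y x) (Z x)) (X \<rho>) \<rho>
      = g \<rho> (wasserstein_connection X Y \<rho>) (Z \<rho>) + g \<rho> (Y \<rho>) (wasserstein_connection X Z \<rho>)"
    using dir_deriv_metric[OF Y Z \<rho>, of "X \<rho>"] metric_christoffel_compatible[OF \<rho>, of "Y \<rho>" "Z \<rho>" "X \<rho>"]
    by (simp add: wasserstein_connection_def bilinear_ladd[OF bilinear_metric]
        bilinear_radd[OF bilinear_metric])
qed

text \<open>Constant fields commute, so the difference \<open>d\<close> from the Christoffel symbols is symmetric by
  torsion-freeness, and \<open>g \<rho> (d u v) w\<close> is skew in \<^term>\<open>v\<close>, \<^term>\<open>w\<close> by compatibility with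
  the metric.  A trilinear form that is symmetric in its first two and skew in its last two
  arguments vanishes.\<close>

lemma levi_civita_on_constants:
  assumes D: "levi_civita g D" and \<rho>: "\<rho> \<in> prob_plus" and u: "u \<in> tangent" and v: "v \<in> tangent"
  shows "D (\<lambda>x. u) (\<lambda>x. v) \<rho> = christoffel \<rho> u v"
proof -
  define d where "d u v = D (\<lambda>x. u) (\<lambda>x. v) \<rho> - christoffel \<rho> u v" for u v
  note vf = const_in_vector_fields
  have torsion: "\<forall>X\<in>vector_fields. \<forall>Y\<in>vector_fields. \<forall>\<rho>\<in>prob_plus.
      D X Y \<rho> - D Y X \<rho> = lie_bracket X Y \<rho>"
    and compatible: "\<forall>X\<in>vector_fields. \<forall>Y\<in>vector_fields. \<forall>Z\<in>vector_fields. \<forall>\<rho>\<in>prob_plus.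
      dir_deriv (\<lambda>x. g x (Y x) (Z x)) (X \<rho>) \<rho> = g \<rho> (D X Y \<rho>) (Z \<rho>) + g \<rho> (Y \<rho>) (D X Z \<rho>)"
    using D unfolding levi_civita_def by - (elim conjE, assumption)+
  have D_tangent: "D (\<lambda>x. u) (\<lambda>x. v) \<rho> \<in> tangent" if "u \<in> tangent" "v \<in> tangent" for u v
  proof -
    have "\<forall>X\<in>vector_fields. \<forall>Y\<in>vector_fields. D X Y \<in> vector_fields"
      using D unfolding levi_civita_def affine_connection_def by (elim conjE)
    then have "D (\<lambda>x. u) (\<lambda>x. v) \<in> vector_fields"
      using vf that by blast
    then show ?thesis
      using \<rho> by (simp add: vector_fields_def)
  qed
  have d_tangent: "d u v \<in> tangent" if "u \<in> tangent" "v \<in> tangent" for u v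
    unfolding d_def
    by (intro subspace_diff[OF subspace_tangent] D_tangent christoffel_in_tangent that)
  have sym: "d u v = d v u" if "u \<in> tangent" "v \<in> tangent" for u v
  proof -
    have "D (\<lambda>x. u) (\<lambda>x. v) \<rho> - D (\<lambda>x. v) (\<lambda>x. u) \<rho> = lie_bracket (\<lambda>x. u) (\<lambda>x. v) \<rho>"
      using torsion vf[OF that(1)] vf[OF that(2)] \<rho> by blast
    then show ?thesis
      by (simp add: d_def lie_bracket_def christoffel_commute)
  qed
  have skew: "g \<rho> (d u v) w = - g \<rho> (d u w) v"
    if "u \<in> tangent" "v \<in> tangent" "w \<in> tangent" for u v w
  proof -
    have "dir_deriv (\<lambda>x. g x v w) u \<rho>
        = g \<rho> (D (\<lambda>x. u) (\<lambda>x. v) \<rho>) w + g \<rho> v (D (\<lambda>x. u) (\<lambda>x. w) \<rho>)"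
      using compatible[rule_format, OF vf[OF that(1)] vf[OF that(2)] vf[OF that(3)] \<rho>] by simp
    moreover have "dir_deriv (\<lambda>x. g x v w) u \<rho> = g \<rho> (christoffel \<rho> u v) w + g \<rho> v (christoffel \<rho> u w)"
      using dir_deriv_metric[OF vf[OF that(2)] vf[OF that(3)] \<rho> that(1)]
        metric_christoffel_compatible[OF \<rho> that(2,3), of u]
      by (simp add: bilinear_lzero[OF bilinear_metric] bilinear_rzero[OF bilinear_metric])
    ultimately have "g \<rho> (d u v) w + g \<rho> v (d u w) = 0"
      by (simp add: d_def bilinear_lsub[OF bilinear_metric] bilinear_rsub[OF bilinear_metric])
    then show ?thesis
      using metric_commute[OF \<rho> that(2) d_tangent[OF that(1,3)]] by simp
  qed
  have "g \<rho> (d u v) w = 0" if w: "w \<in> tangent" for w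
  proof -
    have "g \<rho> (d u v) w = - g \<rho> (d w u) v"
      using skew[OF u v w] sym[OF u w] by simp
    also have "\<dots> = g \<rho> (d v w) u"
      using skew[OF w u v] sym[OF w v] by simp
    also have "\<dots> = - g \<rho> (d u v) w"
      using skew[OF v w u] sym[OF v u] by simp
    finally show ?thesis by simp
  qed
  then have "d u v = 0"
    by (rule metric_nondegenerate[OF \<rho> d_tangent[OF u v]])
  then show ?thesis
    by (simp add: d_def)
qed

section \<open>Parallel fields along curves\<close>

definition derivative_along :: "(real \<Rightarrow> real^'n) \<Rightarrow> (real \<Rightarrow> real^'n) \<Rightarrow> real \<Rightarrow> real^'n" where
  "derivative_along \<rho> \<sigma> =
     (\<lambda>t. vector_derivative \<sigma> (at t) + christoffel (\<rho> t) (vector_derivative \<rho> (at t)) (\<sigma> t))"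

lemma covariant_derivative_along_wasserstein:
  assumes I: "open I" and \<rho>: "smooth_curve I \<rho>"
  shows "covariant_derivative_along wasserstein_connection I \<rho> (derivative_along \<rho>)"
  unfolding covariant_derivative_along_def
proof (intro conjI ballI allI impI)
  have d\<rho>: "smooth_on UNIV I (\<lambda>t. vector_derivative \<rho> (at t))"
    "\<And>t. t \<in> I \<Longrightarrow> vector_derivative \<rho> (at t) \<in> tangent"
    using vector_derivative_curve_in_fields_along[OF I \<rho>] by (auto simp: fields_along_def)
  have s\<rho>: "smooth_on UNIV I \<rho>" "\<And>t. t \<in> I \<Longrightarrow> \<rho> t \<in> prob_plus"
    using \<rho> by (auto simp: smooth_curve_def)
  fix \<sigma> :: "real \<Rightarrow> real^'n" assume "\<sigma> \<in> fields_along I"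
  then have \<sigma>: "smooth_on UNIV I \<sigma>" "\<And>t. t \<in> I \<Longrightarrow> \<sigma> t \<in> tangent"
    by (auto simp: fields_along_def)
  have "smooth_on UNIV I (derivative_along \<rho> \<sigma>)"
    unfolding derivative_along_def
    by (intro smooth_on_add[OF open_along_open[OF I]] smooth_on_vector_derivative[OF I]
        smooth_on_christoffel[OF open_along_open[OF I]] s\<rho> d\<rho> \<sigma>)
  moreover have "derivative_along \<rho> \<sigma> t \<in> tangent" if "t \<in> I" for t
    unfolding derivative_along_def
    by (intro subspace_add[OF subspace_tangent] christoffel_in_tangent
        vector_derivative_in_tangent[OF I \<sigma>(1) that, where c = 0])
      (use \<sigma>(2) in \<open>simp add: tangent_def\<close>)
  ultimately show "derivative_along \<rho> \<sigma> \<in> fields_along I"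
    by (simp add: fields_along_def)
  fix t assume t: "t \<in> I"
  note d\<sigma> = smooth_on_has_vector_derivative[OF I \<sigma>(1) t]
  show "derivative_along \<rho> \<sigma> t = derivative_along \<rho> \<tau> t" if "\<forall>t\<in>I. \<sigma> t = \<tau> t" for \<tau>
  proof -
    have "\<forall>\<^sub>F s in nhds t. s \<in> UNIV \<longrightarrow> \<sigma> s = \<tau> s"
      using eventually_nhds_in_open[OF I t] by eventually_elim (simp add: that)
    then have "vector_derivative \<sigma> (at t) = vector_derivative \<tau> (at t)"
      by (rule vector_derivative_cong_eq) auto
    then show ?thesis
      using that t by (simp add: derivative_along_def)
  qed
  show "derivative_along \<rho> (\<lambda>s. \<sigma> s + \<tau> s) t
      = derivative_along \<rho> \<sigma> t + derivative_along \<rho> \<tau> t" if "\<tau> \<in> fields_along I" for \<tau>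
  proof -
    have "(\<tau> has_vector_derivative vector_derivative \<tau> (at t)) (at t)"
      using that by (intro smooth_on_has_vector_derivative[OF I _ t]) (simp add: fields_along_def)
    from vector_derivative_at[OF has_vector_derivative_add[OF d\<sigma> this]] show ?thesis
      by (simp add: derivative_along_def bilinear_radd[OF bilinear_christoffel])
  qed
  show "derivative_along \<rho> (\<lambda>s. f s *\<^sub>R \<sigma> s) t
      = f t *\<^sub>R derivative_along \<rho> \<sigma> t + vector_derivative f (at t) *\<^sub>R \<sigma> t"
    if "smooth_on UNIV I f" for f :: "real \<Rightarrow> real"
  proof -
    have "(f has_field_derivative vector_derivative f (at t)) (at t)"
      using smooth_on_has_vector_derivative[OF I that t]
      by (simp add: has_real_derivative_iff_has_vector_derivative)
    from vector_derivative_at[OF has_vector_derivative_scaleR[OF this d\<sigma>]] show ?thesis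
      by (simp add: derivative_along_def bilinear_rmul[OF bilinear_christoffel] algebra_simps)
  qed
next
  fix X Z :: "'n field" and t
  assume "X \<in> vector_fields" "t \<in> I" "Z (\<rho> t) = vector_derivative \<rho> (at t)"
  then show "derivative_along \<rho> (\<lambda>s. X (\<rho> s)) t = wasserstein_connection Z X (\<rho> t)"
    using vector_derivative_along_curve[OF I \<rho>, of X t]
    by (simp add: derivative_along_def wasserstein_connection_def vector_fields_def)
qed

text \<open>The coordinates of \<^term>\<open>\<sigma>\<close> are its coefficients with respect to constant tangent
  generators.  On each generator the chain rule reduces \<^term>\<open>DD\<close> to the connection on constant
  fields, with a constant field extending the velocity of the curve; the Leibniz rule and
  additivity determine the rest.\<close>

lemma covariant_derivative_along_unique:
  assumes D: "levi_civita g D" and DD: "covariant_derivative_along D I \<rho> DD"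
    and I: "open I" and \<rho>: "smooth_curve I \<rho>" and "\<sigma> \<in> fields_along I" and t: "t \<in> I"
  shows "DD \<sigma> t = derivative_along \<rho> \<sigma> t"
proof -
  let ?v = "vector_derivative \<rho> (at t)"
  have \<sigma>: "smooth_on UNIV I \<sigma>" "\<And>t. t \<in> I \<Longrightarrow> \<sigma> t \<in> tangent"
    using assms(5) by (auto simp: fields_along_def)
  have v: "?v \<in> tangent"
    using vector_derivative_curve_in_fields_along[OF I \<rho>] t by (simp add: fields_along_def)
  have Pt: "\<rho> t \<in> prob_plus"
    using \<rho> t by (simp add: smooth_curve_def)
  note open_I = open_along_open[OF I]
  have congruence: "\<forall>\<sigma>\<in>fields_along I. \<forall>\<tau>\<in>fields_along I.
      (\<forall>t\<in>I. \<sigma> t = \<tau> t) \<longrightarrow> (\<forall>t\<in>I. DD \<sigma> t = DD \<tau> t)"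
    and additive: "\<forall>\<sigma>\<in>fields_along I. \<forall>\<tau>\<in>fields_along I. \<forall>t\<in>I.
      DD (\<lambda>s. \<sigma> s + \<tau> s) t = DD \<sigma> t + DD \<tau> t"
    and leibniz: "\<forall>f. smooth_on UNIV I f \<longrightarrow> (\<forall>\<sigma>\<in>fields_along I. \<forall>t\<in>I.
      DD (\<lambda>s. f s *\<^sub>R \<sigma> s) t = f t *\<^sub>R DD \<sigma> t + vector_derivative f (at t) *\<^sub>R \<sigma> t)"
    and chain: "\<forall>X\<in>vector_fields. \<forall>Z\<in>vector_fields. \<forall>t\<in>I.
      Z (\<rho> t) = vector_derivative \<rho> (at t) \<longrightarrow> DD (\<lambda>s. X (\<rho> s)) t = D Z X (\<rho> t)"
    using DD unfolding covariant_derivative_along_def by - (elim conjE, assumption)+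
  let ?e = "\<lambda>k::'n. (\<lambda>s::real. tangent_generator k)"
  define S where "S A = (\<lambda>s. \<Sum>k\<in>A. \<sigma> s $ k *\<^sub>R tangent_generator k)" for A :: "'n set"
  have e: "?e k \<in> fields_along I" for k
    by (simp add: fields_along_def smooth_on_const[OF open_I] tangent_generator_in_tangent)
  have comp: "smooth_on UNIV I (\<lambda>s. \<sigma> s $ k)" for k
    by (rule smooth_on_component[OF open_I \<sigma>(1)])
  have term_along: "(\<lambda>s. \<sigma> s $ k *\<^sub>R tangent_generator k) \<in> fields_along I" for k
    using smooth_on_scaleR[OF open_I comp smooth_on_const[OF open_I]]
    by (simp add: fields_along_def subspace_scale[OF subspace_tangent tangent_generator_in_tangent])
  have S_along: "S A \<in> fields_along I" for A
    unfolding S_def fields_along_def mem_Collect_eq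
    using term_along
    by (auto simp: fields_along_def intro!: smooth_on_sum[OF open_I] subspace_sum[OF subspace_tangent])
  have DD_e: "DD (?e k) t = christoffel (\<rho> t) ?v (tangent_generator k)" for k
  proof -
    have "DD (?e k) t = D (\<lambda>x. ?v) (\<lambda>x. tangent_generator k) (\<rho> t)"
      using chain[rule_format, of "\<lambda>x. tangent_generator k" "\<lambda>x. ?v" t] t
      by (simp add: const_in_vector_fields tangent_generator_in_tangent v)
    then show ?thesis
      using levi_civita_on_constants[OF D Pt v tangent_generator_in_tangent] by simp
  qed
  have DD_term: "DD (\<lambda>s. \<sigma> s $ k *\<^sub>R tangent_generator k) t
      = \<sigma> t $ k *\<^sub>R christoffel (\<rho> t) ?v (tangent_generator k)
        + vector_derivative (\<lambda>s. \<sigma> s $ k) (at t) *\<^sub>R tangent_generator k" for k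
  proof -
    have "DD (\<lambda>s. \<sigma> s $ k *\<^sub>R ?e k s) t
        = \<sigma> t $ k *\<^sub>R DD (?e k) t + vector_derivative (\<lambda>s. \<sigma> s $ k) (at t) *\<^sub>R ?e k t"
      by (rule leibniz[rule_format, OF comp e t])
    then show ?thesis by (simp add: DD_e)
  qed
  have DD_add: "DD (\<lambda>s. \<alpha> s + \<beta> s) t = DD \<alpha> t + DD \<beta> t"
    if "\<alpha> \<in> fields_along I" "\<beta> \<in> fields_along I" for \<alpha> \<beta>
    by (rule additive[rule_format, OF that t])
  have DD_sum: "DD (S A) t = (\<Sum>k\<in>A. DD (\<lambda>s. \<sigma> s $ k *\<^sub>R tangent_generator k) t)" if "finite A" for A
    using that
  proof (induction A)
    case empty
    have "DD (\<lambda>s. 0 + 0) t = DD (\<lambda>s. 0) t + DD (\<lambda>s. 0) t"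
      by (rule DD_add)
        (auto simp: fields_along_def smooth_on_const[OF open_I] subspace_0[OF subspace_tangent])
    then show ?case by (simp add: S_def)
  next
    case (insert k A)
    have "S (insert k A) = (\<lambda>s. \<sigma> s $ k *\<^sub>R tangent_generator k + S A s)"
      using insert.hyps by (simp add: S_def)
    then show ?case
      using DD_add[OF term_along S_along] insert by simp
  qed
  have "DD \<sigma> t = DD (S UNIV) t"
  proof -
    have "\<forall>s\<in>I. \<sigma> s = S UNIV s"
      by (simp add: S_def tangent_expansion \<sigma>(2))
    then show ?thesis
      using congruence S_along assms(5) t by blast
  qed
  also have "\<dots> = (\<Sum>k\<in>UNIV. \<sigma> t $ k *\<^sub>R christoffel (\<rho> t) ?v (tangent_generator k))
      + (\<Sum>k\<in>UNIV. vector_derivative (\<lambda>s. \<sigma> s $ k) (at t) *\<^sub>R tangent_generator k)"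
    by (simp add: DD_sum DD_term sum.distrib)
  also have "(\<Sum>k\<in>UNIV. \<sigma> t $ k *\<^sub>R christoffel (\<rho> t) ?v (tangent_generator k)) = christoffel (\<rho> t) ?v (\<sigma> t)"
  proof -
    have lin: "linear (christoffel (\<rho> t) ?v)"
      using bilinear_christoffel[of "\<rho> t"] by (simp add: bilinear_def)
    have "christoffel (\<rho> t) ?v (\<Sum>k\<in>UNIV. \<sigma> t $ k *\<^sub>R tangent_generator k)
        = (\<Sum>k\<in>UNIV. \<sigma> t $ k *\<^sub>R christoffel (\<rho> t) ?v (tangent_generator k))"
      by (simp add: linear_sum[OF lin] linear_cmul[OF lin])
    then show ?thesis
      by (simp add: tangent_expansion[OF \<sigma>(2)[OF t]])
  qed
  also have "(\<Sum>k\<in>UNIV. vector_derivative (\<lambda>s. \<sigma> s $ k) (at t) *\<^sub>R tangent_generator k)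
      = vector_derivative \<sigma> (at t)"
  proof -
    have "vector_derivative (\<lambda>s. \<sigma> s $ k) (at t) = vector_derivative \<sigma> (at t) $ k" for k
      by (rule vector_derivative_at)
        (rule bounded_linear.has_vector_derivative[OF bounded_linear_vec_nth
            smooth_on_has_vector_derivative[OF I \<sigma>(1) t]])
    moreover have "vector_derivative \<sigma> (at t) \<in> tangent"
      by (rule vector_derivative_in_tangent[OF I \<sigma>(1) t, where c = 0])
        (use \<sigma>(2) in \<open>simp add: tangent_def\<close>)
    ultimately show ?thesis
      by (simp add: tangent_expansion)
  qed
  finally show ?thesis
    by (simp add: derivative_along_def)
qed

lemma parallel_along_iff:
  assumes I: "open I" and \<rho>: "smooth_curve I \<rho>" and \<sigma>: "\<sigma> \<in> fields_along I"
  shows "parallel_along g I \<rho> \<sigma> \<longleftrightarrow> (\<forall>t\<in>I. derivative_along \<rho> \<sigma> t = 0)"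
proof
  assume "parallel_along g I \<rho> \<sigma>"
  then obtain D DD where D: "levi_civita g D" "covariant_derivative_along D I \<rho> DD"
    and zero: "\<forall>t\<in>I. DD \<sigma> t = 0"
    unfolding parallel_along_def by blast
  then show "\<forall>t\<in>I. derivative_along \<rho> \<sigma> t = 0"
    using covariant_derivative_along_unique[OF D I \<rho> \<sigma>] by simp
next
  assume "\<forall>t\<in>I. derivative_along \<rho> \<sigma> t = 0"
  then show "parallel_along g I \<rho> \<sigma>"
    unfolding parallel_along_def
    using levi_civita_wasserstein covariant_derivative_along_wasserstein[OF I \<rho>] by blast
qed

end

theorem proposition5:
  fixes E :: "('n::finite \<times> 'n) set" and \<omega> :: "'n \<Rightarrow> 'n \<Rightarrow> real"
    and a b :: real and \<rho> \<sigma> :: "real \<Rightarrow> real^'n"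
  assumes graph: "connected_weighted_graph E \<omega>"
    and ab: "a < b"
    and curve: "smooth_curve {a<..<b} \<rho>"
    and field: "\<sigma> \<in> fields_along {a<..<b}"
  shows
    "(parallel_along (wasserstein_metric E \<omega>) {a<..<b} \<rho> \<sigma> \<longleftrightarrow>
       (\<forall>t\<in>{a<..<b}.
          vector_derivative \<sigma> (at t)
          - (1/2) *\<^sub>R
             (laplacian E \<omega> (\<sigma> t) *v ((laplacian E \<omega> (\<rho> t))\<^sup>\<dagger> *v vector_derivative \<rho> (at t))
              + laplacian E \<omega> (vector_derivative \<rho> (at t)) *v ((laplacian E \<omega> (\<rho> t))\<^sup>\<dagger> *v \<sigma> t))
          + (1/2) *\<^sub>R
             (laplacian E \<omega> (\<rho> t) *v
                field_prod E
                  (graph_grad \<omega> ((laplacian E \<omega> (\<rho> t))\<^sup>\<dagger> *v vector_derivative \<rho> (at t)))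
                  (graph_grad \<omega> ((laplacian E \<omega> (\<rho> t))\<^sup>\<dagger> *v \<sigma> t)))
          = 0))
     \<and>
     (geodesic (wasserstein_metric E \<omega>) {a<..<b} \<rho> \<longleftrightarrow>
       (\<forall>t\<in>{a<..<b}.
          vector_derivative (\<lambda>s. vector_derivative \<rho> (at s)) (at t)
          - laplacian E \<omega> (vector_derivative \<rho> (at t)) *v
              ((laplacian E \<omega> (\<rho> t))\<^sup>\<dagger> *v vector_derivative \<rho> (at t))
          + (1/2) *\<^sub>R
             (laplacian E \<omega> (\<rho> t) *v
                field_prod E
                  (graph_grad \<omega> ((laplacian E \<omega> (\<rho> t))\<^sup>\<dagger> *v vector_derivative \<rho> (at t)))
                  (graph_grad \<omega> ((laplacian E \<omega> (\<rho> t))\<^sup>\<dagger> *v vector_derivative \<rho> (at t))))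
          = 0))"
proof -
  have I: "open {a<..<b}" by simp
  show ?thesis
    unfolding geodesic_def parallel_along_iff[OF graph I curve field]
      parallel_along_iff[OF graph I curve vector_derivative_curve_in_fields_along[OF I curve]]
    unfolding derivative_along_def[OF graph] christoffel_self[OF graph]
    unfolding christoffel_def[OF graph]
    by (simp add: algebra_simps)
qed

end
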